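(* Let $F_2$ be the free group on $a,b$, let $Y\subset F_2$ be the set of elements of the form $a^nw$ with $n\in\mathbb{Z}$ and $w$ a (possibly empty) positive word in $a,b$, and let $C^*(Y)\cong\mathcal{O}_2$ be its partial translation algebra. Let $G=H\ltimes F_2$, let $\Phi\colon G\to Y$ be the explicit bijection given in the context, and let $\Phi_*\colon B(\ell^2(G))\to B(\ell^2(Y))$ be the induced isomorphism. Then the image of $C^*_\rho(F_2)\otimes 1\subset B(\ell^2(G))$ under $\Phi_*$ is contained in $C^*(Y)\cong\mathcal{O}_2$.
   Context: Partial translation algebra: for $g\in F_2$, the partial translation by $g$ on $Y$ is the map $y\mapsto yg$ with domain $\{y\in Y:yg\in Y\}$, regarded as the partial isometry of $\ell^2(Y)$ sending $\delta_y$ to $\delta_{yg}$ if $yg\in Y$ and to $0$ otherwise. $C^*(Y)\subset B(\ell^2(Y))$ is the $C^*$-algebra generated by these operators for all $g\in F_2$. It is isomorphic to the Cuntz algebra $\mathcal{O}_2$, being generated by the two isometries $s_a,s_b$ given by right multiplication by $a$ and by $b$, which satisfy $s_as_a^*+s_bs_b^*=1$. The group $G$: let $\alpha$ be the automorphism of $F_2$ with $\alpha(a)=b$, $\alpha(b)=a^{-1}$, let $H=\langle\alpha\rangle$ (cyclic of order 4), and let $G=H\ltimes F_2$, i.e. the group generated by $a,b,\alpha$ with relations $\alpha^4=1$, $\alpha a\alpha^{-1}=b$, $\alpha b\alpha^{-1}=a^{-1}$. Normal form: every element of $G$ can be written uniquely as $$x=a^{-n}\alpha^{i_0}a\alpha^{i_1}a\cdots\alpha^{i_{d-1}}a\alpha^{i_d},$$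 with $n,d\ge0$, $i_j\in\{-1,0,1\}$ for $j<d$, $i_d\in\mathbb{Z}/4\mathbb{Z}$, and $i_0\ne0$ if $n>0$ and $d>0$. Put $h(x)=-i_d\in\mathbb{Z}/4\mathbb{Z}$. The map $\Phi$: put $u_0=a$, $u_1=b^2$, $u_{-1}=ab$, and $v_0=a^2$, $v_1=b^2$, $v_2=ab$, $v_3=ba$ (indices of $v$ modulo 4). For $x\in G$ written uniquely as $x=a^{-n}\alpha^{i_0}a\alpha^{i_1}a\cdots\alpha^{i_{d-1}}a\alpha^{i_d}$ with $n,d\ge0$, $i_j\in\{-1,0,1\}$ for $j<d$, $i_d\in\mathbb{Z}/4\mathbb{Z}$, and $i_0\ne0$ if $n>0$ and $d>0$, define $$\Phi(x)=a^{-n}u_{i_0}u_{i_1}\cdots u_{i_{d-1}}v_{h(x)}\in Y$$ (product in $F_2$). This is a bijection $G\to Y$. Let $U\colon\ell^2(G)\to\ell^2(Y)$ be the unitary $\delta_x\mapsto\delta_{\Phi(x)}$ and $\Phi_*(T)=UTU^*$. The algebra $C^*_\rho(F_2)\otimes1$: $\rho$ is the right regular representation of $F_2$ on $\ell^2(F_2)$, and $C^*_\rho(F_2)$ is the reduced $C^*$-algebra it generates. $G$ is the disjoint union of the four left cosets $\alpha^jF_2$, so $\ell^2(G)\cong\ell^2(F_2)\otimes\ell^2(H)$ via $\delta_{\alpha^jx}\leftrightarrow\delta_x\otimes\delta_{\alpha^j}$ (the coset representatives $\alpha^j$ correspond under $\Phi$ to the set $I=\{v_0,v_1,v_2,v_3\}$).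 Under this identification $C^*_\rho(F_2)\otimes1$ is the $C^*$-subalgebra of $B(\ell^2(G))$ generated by the right multiplication operators $\delta_x\mapsto\delta_{xg}$, $x\in G$, $g\in F_2$. *)

theory Defs
  imports "HOL-Analysis.Analysis"
begin

definition square_summable :: "('a \<Rightarrow> complex) \<Rightarrow> bool" where
  "square_summable f \<longleftrightarrow> (\<lambda>x. (cmod (f x))\<^sup>2) summable_on UNIV"

definition ell2_norm :: "('a \<Rightarrow> complex) \<Rightarrow> real" where
  "ell2_norm f = sqrt (\<Sum>\<^sub>\<infinity>x. (cmod (f x))\<^sup>2)"

lemma square_summableI:
  assumes "\<And>F. finite F \<Longrightarrow> L2_set (\<lambda>x. cmod (f x)) F \<le> K"
  shows "square_summable f"
  unfolding square_summable_def
proof (rule nonneg_bounded_partial_sums_imp_summable_on[where C = "K\<^sup>2"])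
  show "\<forall>\<^sub>F F in finite_subsets_at_top UNIV. (\<Sum>x\<in>F. (cmod (f x))\<^sup>2) \<le> K\<^sup>2"
  proof (rule eventually_finite_subsets_at_top_weakI)
    fix F :: "'a set" assume "finite F"
    from assms[OF this] have "sqrt (\<Sum>x\<in>F. (cmod (f x))\<^sup>2) \<le> K"
      by (simp add: L2_set_def)
    then show "(\<Sum>x\<in>F. (cmod (f x))\<^sup>2) \<le> K\<^sup>2"
      by (simp add: sqrt_le_D)
  qed
qed auto

lemma L2_set_le_ell2_norm:
  assumes "square_summable f" "finite F"
  shows "L2_set (\<lambda>x. cmod (f x)) F \<le> ell2_norm f"
  unfolding L2_set_def ell2_norm_def
  using assms by (intro real_sqrt_le_mono finite_sum_le_infsum) (auto simp: square_summable_def)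

lemma ell2_norm_leI:
  assumes "\<And>F. finite F \<Longrightarrow> L2_set (\<lambda>x. cmod (f x)) F \<le> K"
  shows "ell2_norm f \<le> K"
proof -
  have K: "0 \<le> K" using assms[of "{}"] by simp
  have "(\<Sum>\<^sub>\<infinity>x. (cmod (f x))\<^sup>2) \<le> K\<^sup>2"
  proof (rule infsum_le_finite_sums)
    show "(\<lambda>x. (cmod (f x))\<^sup>2) summable_on UNIV"
      using square_summableI[OF assms] by (simp add: square_summable_def)
    fix F :: "'a set" assume "finite F"
    from assms[OF this] have "sqrt (\<Sum>x\<in>F. (cmod (f x))\<^sup>2) \<le> K"
      by (simp add: L2_set_def)
    then show "(\<Sum>x\<in>F. (cmod (f x))\<^sup>2) \<le> K\<^sup>2"
      by (simp add: sqrt_le_D)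
  qed
  then show ?thesis using K by (simp add: ell2_norm_def real_le_lsqrt)
qed

lemma ell2_norm_nonneg: "0 \<le> ell2_norm f"
  by (simp add: ell2_norm_def infsum_nonneg)

lemma L2_set_add_le_ell2_norm:
  assumes "square_summable f" "square_summable g" "finite F"
  shows "L2_set (\<lambda>x. cmod (f x + g x)) F \<le> ell2_norm f + ell2_norm g"
proof -
  have "L2_set (\<lambda>x. cmod (f x + g x)) F \<le> L2_set (\<lambda>x. cmod (f x) + cmod (g x)) F"
    by (intro L2_set_mono) (auto simp: norm_triangle_ineq)
  also have "\<dots> \<le> L2_set (\<lambda>x. cmod (f x)) F + L2_set (\<lambda>x. cmod (g x)) F"
    by (rule L2_set_triangle_ineq)
  also have "\<dots> \<le> ell2_norm f + ell2_norm g"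
    by (intro add_mono L2_set_le_ell2_norm assms)
  finally show ?thesis .
qed

lemma L2_set_scale_le_ell2_norm:
  assumes "square_summable f" "finite F"
  shows "L2_set (\<lambda>x. cmod (c * f x)) F \<le> cmod c * ell2_norm f"
  using L2_set_le_ell2_norm[OF assms]
  by (simp add: norm_mult L2_set_right_distrib[symmetric] mult_left_mono)

typedef 'a ell2 = "{f :: 'a \<Rightarrow> complex. square_summable f}"
  morphisms ell2_coeff Abs_ell2
  by (rule exI[of _ "\<lambda>_. 0"]) (simp add: square_summable_def)

setup_lifting type_definition_ell2

lift_definition scaleC :: "complex \<Rightarrow> 'a ell2 \<Rightarrow> 'a ell2" (infixr \<open>*\<^sub>C\<close> 75)
  is "\<lambda>c f x. c * f x"
  by (blast intro: square_summableI L2_set_scale_le_ell2_norm)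

instantiation ell2 :: (type) real_normed_vector
begin

lift_definition zero_ell2 :: "'a ell2" is "\<lambda>_. 0"
  by (simp add: square_summable_def)

lift_definition plus_ell2 :: "'a ell2 \<Rightarrow> 'a ell2 \<Rightarrow> 'a ell2" is "\<lambda>f g x. f x + g x"
  by (blast intro: square_summableI L2_set_add_le_ell2_norm)

lift_definition uminus_ell2 :: "'a ell2 \<Rightarrow> 'a ell2" is "\<lambda>f x. - f x"
  by (simp add: square_summable_def)

definition minus_ell2 :: "'a ell2 \<Rightarrow> 'a ell2 \<Rightarrow> 'a ell2" where
  "f - g = f + - g" for f g :: "'a ell2"

definition scaleR_ell2 :: "real \<Rightarrow> 'a ell2 \<Rightarrow> 'a ell2" where
  "scaleR_ell2 r f = complex_of_real r *\<^sub>C f"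

lift_definition norm_ell2 :: "'a ell2 \<Rightarrow> real" is ell2_norm .

definition sgn_ell2 :: "'a ell2 \<Rightarrow> 'a ell2" where
  "sgn_ell2 f = inverse (norm f) *\<^sub>R f"

definition dist_ell2 :: "'a ell2 \<Rightarrow> 'a ell2 \<Rightarrow> real" where
  "dist_ell2 f g = norm (f - g)"

definition uniformity_ell2 :: "('a ell2 \<times> 'a ell2) filter" where
  "uniformity_ell2 = (INF e\<in>{0<..}. principal {(f, g). dist f g < e})"

definition open_ell2 :: "'a ell2 set \<Rightarrow> bool" where
  "open_ell2 S \<longleftrightarrow> (\<forall>f\<in>S. \<forall>\<^sub>F (f', g) in uniformity. f' = f \<longrightarrow> g \<in> S)"

instance
proof
  fix f g h :: "'a ell2" and r s :: real
  show "f + g + h = f + (g + h)" "f + g = g + f" "0 + f = f" "- f + f = 0"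
    by (transfer; simp add: algebra_simps)+
  show "f - g = f + - g" by (rule minus_ell2_def)
  show "r *\<^sub>R (f + g) = r *\<^sub>R f + r *\<^sub>R g" "(r + s) *\<^sub>R f = r *\<^sub>R f + s *\<^sub>R f"
    "r *\<^sub>R s *\<^sub>R f = (r * s) *\<^sub>R f" "1 *\<^sub>R f = f"
    unfolding scaleR_ell2_def by (transfer; simp add: algebra_simps)+
  show "dist f g = norm (f - g)" by (rule dist_ell2_def)
  show "sgn f = inverse (norm f) *\<^sub>R f" by (rule sgn_ell2_def)
  show "(uniformity :: ('a ell2 \<times> 'a ell2) filter) = (INF e\<in>{0<..}. principal {(f, g). dist f g < e})"
    by (rule uniformity_ell2_def)
  show "open S \<longleftrightarrow> (\<forall>f\<in>S. \<forall>\<^sub>F (f', g) in uniformity. f' = f \<longrightarrow> g \<in> S)" for S :: "'a ell2 set"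
    by (rule open_ell2_def)
  show "norm f = 0 \<longleftrightarrow> f = 0"
  proof transfer
    fix f :: "'a \<Rightarrow> complex" assume f: "square_summable f"
    show "ell2_norm f = 0 \<longleftrightarrow> f = (\<lambda>_. 0)"
    proof
      assume "ell2_norm f = 0"
      then have "cmod (f x) \<le> 0" for x
        using L2_set_le_ell2_norm[OF f, of "{x}"] by (simp add: L2_set_def)
      then show "f = (\<lambda>_. 0)" by auto
    qed (simp add: ell2_norm_def)
  qed
  show "norm (f + g) \<le> norm f + norm g"
    by transfer (blast intro: ell2_norm_leI L2_set_add_le_ell2_norm)
  show "norm (r *\<^sub>R f) = \<bar>r\<bar> * norm f"
    unfolding scaleR_ell2_def
  proof transfer
    fix r :: real and f :: "'a \<Rightarrow> complex"
    have "(\<Sum>\<^sub>\<infinity>x. (cmod (complex_of_real r * f x))\<^sup>2) = r\<^sup>2 * (\<Sum>\<^sub>\<infinity>x. (cmod (f x))\<^sup>2)"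
      by (simp add: norm_mult power_mult_distrib infsum_cmult_right')
    then show "ell2_norm (\<lambda>x. complex_of_real r * f x) = \<bar>r\<bar> * ell2_norm f"
      by (simp add: ell2_norm_def real_sqrt_mult)
  qed
qed

end

definition cinner :: "'a ell2 \<Rightarrow> 'a ell2 \<Rightarrow> complex" where
  "cinner f g = (\<Sum>\<^sub>\<infinity>x. cnj (ell2_coeff f x) * ell2_coeff g x)"

lift_definition ket :: "'a \<Rightarrow> 'a ell2" is "\<lambda>a x. if x = a then 1 else 0"
  by (auto simp: square_summable_def intro!: finite_nonzero_values_imp_summable_on)

definition clinear_op :: "('a ell2 \<Rightarrow>\<^sub>L 'b ell2) \<Rightarrow> bool" where
  "clinear_op T \<longleftrightarrow> (\<forall>c f. blinfun_apply T (c *\<^sub>C f) = c *\<^sub>C blinfun_apply T f)"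

lemma coeff_minus: "ell2_coeff (f - g) x = ell2_coeff f x - ell2_coeff g x"
  unfolding minus_ell2_def by transfer simp

lemma bounded_linear_scaleC: "bounded_linear (\<lambda>f :: 'a ell2. c *\<^sub>C f)"
proof (rule bounded_linear_intro[where K = "cmod c"])
  fix f g :: "'a ell2" and r :: real
  show "c *\<^sub>C (f + g) = c *\<^sub>C f + c *\<^sub>C g" by transfer (simp add: algebra_simps)
  show "c *\<^sub>C r *\<^sub>R f = r *\<^sub>R c *\<^sub>C f"
    unfolding scaleR_ell2_def by transfer (simp add: algebra_simps)
  show "norm (c *\<^sub>C f) \<le> norm f * cmod c"
    by transfer (subst mult.commute, blast intro: ell2_norm_leI L2_set_scale_le_ell2_norm)
qed

definition scale_op :: "complex \<Rightarrow> ('a ell2 \<Rightarrow>\<^sub>L 'b ell2) \<Rightarrow> ('a ell2 \<Rightarrow>\<^sub>L 'b ell2)" where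
  "scale_op c T = Blinfun (\<lambda>f. c *\<^sub>C blinfun_apply T f)"

lemma scale_op_apply: "blinfun_apply (scale_op c T) f = c *\<^sub>C blinfun_apply T f"
  unfolding scale_op_def
  by (simp add: bounded_linear_Blinfun_apply
        bounded_linear_compose[OF bounded_linear_scaleC blinfun.bounded_linear_right])

lemma cinner_summable:
  "(\<lambda>x. cnj (ell2_coeff f x) * ell2_coeff g x) summable_on UNIV"
  and cinner_bound: "cmod (cinner f g) \<le> norm f * norm g"
proof -
  let ?t = "\<lambda>x. cnj (ell2_coeff f x) * ell2_coeff g x"
  have le: "(\<Sum>x\<in>F. norm (?t x)) \<le> norm f * norm g" if "finite F" for F
  proof -
    have "(\<Sum>x\<in>F. norm (?t x)) = (\<Sum>x\<in>F. \<bar>cmod (ell2_coeff f x)\<bar> * \<bar>cmod (ell2_coeff g x)\<bar>)"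
      by (simp add: norm_mult)
    also have "\<dots> \<le> L2_set (\<lambda>x. cmod (ell2_coeff f x)) F * L2_set (\<lambda>x. cmod (ell2_coeff g x)) F"
      by (rule L2_set_mult_ineq)
    also have "\<dots> \<le> norm f * norm g"
      unfolding norm_ell2.rep_eq using that ell2_coeff
      by (intro mult_mono L2_set_le_ell2_norm) (auto simp: ell2_norm_nonneg)
    finally show ?thesis .
  qed
  have abs: "(\<lambda>x. norm (?t x)) summable_on UNIV"
    by (rule nonneg_bounded_partial_sums_imp_summable_on[where C = "norm f * norm g"])
       (auto intro!: eventually_finite_subsets_at_top_weakI le)
  then show "?t summable_on UNIV" by (rule abs_summable_summable)
  have "cmod (cinner f g) \<le> (\<Sum>\<^sub>\<infinity>x. norm (?t x))"
    unfolding cinner_def by (rule norm_infsum_bound[OF abs])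
  also have "\<dots> \<le> norm f * norm g"
    by (rule infsum_le_finite_sums[OF abs]) (rule le)
  finally show "cmod (cinner f g) \<le> norm f * norm g" .
qed

lemma cinner_add_left: "cinner (f + f') g = cinner f g + cinner f' g"
  and cinner_add_right: "cinner h (f + f') = cinner h f + cinner h f'"
  unfolding cinner_def plus_ell2.rep_eq
  by (simp_all add: distrib_left distrib_right infsum_add[OF cinner_summable cinner_summable])

lemma cinner_scaleC_left: "cinner (c *\<^sub>C f) g = cnj c * cinner f g"
  unfolding cinner_def scaleC.rep_eq infsum_cmult_right'[symmetric] by (simp add: mult.assoc)

lemma cinner_scaleC_right: "cinner f (c *\<^sub>C g) = c * cinner f g"
  unfolding cinner_def scaleC.rep_eq infsum_cmult_right'[symmetric] by (simp add: ac_simps)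

lemma cinner_ket_left: "cinner (ket x) g = ell2_coeff g x"
proof -
  have "cinner (ket x) g = (\<Sum>\<^sub>\<infinity>y\<in>{x}. cnj (ell2_coeff (ket x) y) * ell2_coeff g y)"
    unfolding cinner_def by (rule infsum_cong_neutral) (auto simp: ket.rep_eq)
  then show ?thesis by (simp add: ket.rep_eq)
qed

lemma bounded_linear_cinner_left: "bounded_linear (\<lambda>f. cinner f g)"
proof (rule bounded_linear_intro[where K = "norm g"])
  show "cinner (r *\<^sub>R f) g = r *\<^sub>R cinner f g" for r f
    by (simp add: scaleR_ell2_def cinner_scaleC_left scaleR_conv_of_real)
qed (simp_all add: cinner_add_left cinner_bound)

lemma coeff_sum: "ell2_coeff (sum h F) x = (\<Sum>i\<in>F. ell2_coeff (h i) x)"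
  by (induction F rule: infinite_finite_induct) (auto simp: zero_ell2.rep_eq plus_ell2.rep_eq)

lemma coeff_ket_sum:
  assumes "finite F"
  shows "ell2_coeff (\<Sum>x\<in>F. c x *\<^sub>C ket x) y = (if y \<in> F then c y else 0)"
  using assms by (simp add: coeff_sum scaleC.rep_eq ket.rep_eq if_distrib[of "(*) _"] cong: if_cong)

lemma norm_ket_sum:
  assumes "finite F"
  shows "norm (\<Sum>x\<in>F. c x *\<^sub>C ket x) = L2_set (\<lambda>x. cmod (c x)) F"
proof -
  have "(\<Sum>\<^sub>\<infinity>y. (cmod (if y \<in> F then c y else 0))\<^sup>2) = (\<Sum>\<^sub>\<infinity>y\<in>F. (cmod (c y))\<^sup>2)"
    by (rule infsum_cong_neutral) auto
  then show ?thesis using assms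
    by (simp add: norm_ell2.rep_eq ell2_norm_def coeff_ket_sum L2_set_def)
qed

lemma has_sum_ket: "((\<lambda>x. ell2_coeff f x *\<^sub>C ket x) has_sum f) UNIV"
proof -
  define q where "q x = (cmod (ell2_coeff f x))\<^sup>2" for x
  have q: "q summable_on UNIV"
    unfolding q_def using ell2_coeff[of f] by (simp add: square_summable_def)
  define s where "s F = (\<Sum>x\<in>F. ell2_coeff f x *\<^sub>C ket x)" for F
  have eq: "(norm (s F - f))\<^sup>2 = infsum q UNIV - sum q F" if F: "finite F" for F
  proof -
    have "ell2_coeff (s F - f) x = (if x \<in> F then 0 else - ell2_coeff f x)" for x
      by (simp add: s_def coeff_minus coeff_ket_sum[OF F])
    then have "(norm (s F - f))\<^sup>2 = (\<Sum>\<^sub>\<infinity>x. (cmod (if x \<in> F then 0 else - ell2_coeff f x))\<^sup>2)"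
      by (simp add: norm_ell2.rep_eq ell2_norm_def infsum_nonneg)
    also have "\<dots> = infsum q (UNIV - F)"
      by (rule infsum_cong_neutral) (auto simp: q_def)
    also have "\<dots> = infsum q UNIV - infsum q F"
      using F by (intro infsum_Diff q) auto
    finally show ?thesis using F by simp
  qed
  have "((\<lambda>F. infsum q UNIV - sum q F) \<longlongrightarrow> infsum q UNIV - infsum q UNIV)
          (finite_subsets_at_top UNIV)"
    using infsum_tendsto[OF q] by (intro tendsto_intros)
  then have "((\<lambda>F. sqrt (infsum q UNIV - sum q F)) \<longlongrightarrow> sqrt 0) (finite_subsets_at_top UNIV)"
    by (intro tendsto_real_sqrt) simp
  moreover have "\<forall>\<^sub>F F in finite_subsets_at_top UNIV. sqrt (infsum q UNIV - sum q F) = norm (s F - f)"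
    by (rule eventually_finite_subsets_at_top_weakI) (simp flip: eq)
  ultimately have "((\<lambda>F. norm (s F - f)) \<longlongrightarrow> 0) (finite_subsets_at_top UNIV)"
    by (simp add: tendsto_cong)
  then have "((\<lambda>F. s F - f) \<longlongrightarrow> 0) (finite_subsets_at_top UNIV)"
    by (rule tendsto_norm_zero_cancel)
  then show ?thesis
    unfolding has_sum_def s_def by (simp add: LIM_zero_iff)
qed

definition adj :: "('a ell2 \<Rightarrow>\<^sub>L 'b ell2) \<Rightarrow> ('b ell2 \<Rightarrow>\<^sub>L 'a ell2)" where
  "adj T = (THE S. \<forall>f g. cinner (blinfun_apply T f) g = cinner f (blinfun_apply S g))"

lemma ex1_adj:
  fixes T :: "'a ell2 \<Rightarrow>\<^sub>L 'b ell2"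
  assumes "clinear_op T"
  shows "\<exists>!S. \<forall>f g. cinner (blinfun_apply T f) g = cinner f (blinfun_apply S g)"
proof (rule ex_ex1I)
  define c where "c g x = cinner (blinfun_apply T (ket x)) g" for g x
  have T: "blinfun_apply T (z *\<^sub>C f) = z *\<^sub>C blinfun_apply T f" for z f
    using assms by (simp add: clinear_op_def)
  have le: "L2_set (\<lambda>x. cmod (c g x)) F \<le> norm T * norm g" if F: "finite F" for F g
  proof -
    let ?h = "\<Sum>x\<in>F. c g x *\<^sub>C ket x"
    let ?L = "L2_set (\<lambda>x. cmod (c g x)) F"
    have "cinner (blinfun_apply T ?h) g = (\<Sum>x\<in>F. cinner (blinfun_apply T (c g x *\<^sub>C ket x)) g)"
      by (simp add: blinfun.sum_right linear_sum[OF bounded_linear.linear[OF bounded_linear_cinner_left]])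
    also have "\<dots> = (\<Sum>x\<in>F. cnj (c g x) * c g x)"
      by (simp add: T cinner_scaleC_left c_def)
    also have "\<dots> = complex_of_real (\<Sum>x\<in>F. (cmod (c g x))\<^sup>2)"
      by (simp add: complex_norm_square mult.commute del: of_real_power)
    also have "(\<Sum>x\<in>F. (cmod (c g x))\<^sup>2) = ?L\<^sup>2"
      by (simp add: L2_set_def sum_nonneg)
    finally have "?L\<^sup>2 = cmod (cinner (blinfun_apply T ?h) g)"
      by (simp flip: of_real_power)
    also have "\<dots> \<le> norm (blinfun_apply T ?h) * norm g" by (rule cinner_bound)
    also have "\<dots> \<le> norm T * norm ?h * norm g"
      by (intro mult_right_mono norm_blinfun) auto
    also have "\<dots> = ?L * (norm T * norm g)"
      by (simp add: norm_ket_sum[OF F])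
    finally have "?L * ?L \<le> ?L * (norm T * norm g)" by (simp add: power2_eq_square)
    then show ?thesis
      by (cases "?L = 0") (use L2_set_nonneg[of "\<lambda>x. cmod (c g x)" F] in auto)
  qed
  define S0 where "S0 g = Abs_ell2 (c g)" for g
  have S0: "ell2_coeff (S0 g) = c g" for g
    unfolding S0_def using square_summableI[OF le] by (simp add: Abs_ell2_inverse)
  have bl: "bounded_linear S0"
  proof (rule bounded_linear_intro[where K = "norm T"])
    fix g g' r
    show "S0 (g + g') = S0 g + S0 g'"
      by (simp add: S0 plus_ell2.rep_eq c_def cinner_add_right fun_eq_iff flip: ell2_coeff_inject)
    show "S0 (r *\<^sub>R g) = r *\<^sub>R S0 g"
      by (simp add: S0 scaleR_ell2_def scaleC.rep_eq c_def cinner_scaleC_right fun_eq_iff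
               flip: ell2_coeff_inject)
    show "norm (S0 g) \<le> norm g * norm T"
      unfolding norm_ell2.rep_eq S0 using le[of _ g]
      by (intro ell2_norm_leI) (simp add: mult.commute norm_ell2.rep_eq)
  qed
  have "cinner (blinfun_apply T f) g = cinner f (S0 g)" for f g
  proof -
    have "bounded_linear (\<lambda>f. cinner (blinfun_apply T f) g)"
      by (intro bounded_linear_compose[OF bounded_linear_cinner_left] blinfun.bounded_linear_right)
    from has_sum_bounded_linear[OF this has_sum_ket[of f]]
    have "((\<lambda>x. cnj (ell2_coeff f x) * ell2_coeff (S0 g) x) has_sum cinner (blinfun_apply T f) g) UNIV"
      by (simp add: o_def T cinner_scaleC_left S0 c_def)
    then show ?thesis unfolding cinner_def[of f] by (simp add: infsumI)
  qed
  then show "\<exists>S. \<forall>f g. cinner (blinfun_apply T f) g = cinner f (blinfun_apply S g)"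
    by (intro exI[of _ "Blinfun S0"]) (simp add: bounded_linear_Blinfun_apply[OF bl])
next
  fix S S'
  assume "\<forall>f g. cinner (blinfun_apply T f) g = cinner f (blinfun_apply S g)"
    and "\<forall>f g. cinner (blinfun_apply T f) g = cinner f (blinfun_apply S' g)"
  then have "cinner (ket x) (blinfun_apply S g) = cinner (ket x) (blinfun_apply S' g)" for x g
    by simp
  then have "ell2_coeff (blinfun_apply S g) = ell2_coeff (blinfun_apply S' g)" for g
    unfolding cinner_ket_left by blast
  then show "S = S'"
    unfolding ell2_coeff_inject by (rule blinfun_eqI)
qed

lemma cinner_adj:
  "clinear_op T \<Longrightarrow> cinner (blinfun_apply T f) g = cinner f (blinfun_apply (adj T) g)"
  using theI'[OF ex1_adj, of T] unfolding adj_def by blast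

text \<open>
  The space \<open>\<Rightarrow>\<^sub>L\<close> consists of the bounded real-linear maps, hence the complex linearity
  requirement; \<open>closed\<close> refers to the operator norm.
\<close>

definition cstar_subalgebra :: "('a ell2 \<Rightarrow>\<^sub>L 'a ell2) set \<Rightarrow> bool" where
  "cstar_subalgebra A \<longleftrightarrow>
     (\<forall>T\<in>A. clinear_op T) \<and> 0 \<in> A \<and>
     (\<forall>S\<in>A. \<forall>T\<in>A. S + T \<in> A \<and> S o\<^sub>L T \<in> A) \<and>
     (\<forall>c. \<forall>T\<in>A. scale_op c T \<in> A) \<and>
     (\<forall>T\<in>A. adj T \<in> A) \<and>
     closed A"

text \<open>
  \<open>basis_op f\<close> is meant for \<open>f\<close> injective on its domain; it then sends \<open>ket x\<close> to
  \<open>ket y\<close> if \<open>f x = Some y\<close> and to \<open>0\<close> if \<open>f x = None\<close> (lemma \<open>basis_op_ket\<close>).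
  The choice operator makes the map contractive for every \<open>f\<close>, so that no side
  condition is needed to obtain a bounded operator.
\<close>

definition push :: "('a \<Rightarrow> 'b option) \<Rightarrow> ('a \<Rightarrow> complex) \<Rightarrow> 'b \<Rightarrow> complex" where
  "push f \<xi> y = (if \<exists>x. f x = Some y then \<xi> (SOME x. f x = Some y) else 0)"

lemma L2_set_push_le:
  assumes "square_summable \<xi>" "finite F"
  shows "L2_set (\<lambda>y. cmod (push f \<xi> y)) F \<le> ell2_norm \<xi>"
proof -
  define F' where "F' = {y\<in>F. \<exists>x. f x = Some y}"
  define s where "s y = (SOME x. f x = Some y)" for y
  have s: "f (s y) = Some y" if "y \<in> F'" for y
    using that someI_ex[of "\<lambda>x. f x = Some y"] by (auto simp: F'_def s_def)
  have inj: "inj_on s F'" by (rule inj_onI) (metis s option.inject)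
  have fin: "finite F'" using assms by (simp add: F'_def)
  have "(\<Sum>y\<in>F. (cmod (push f \<xi> y))\<^sup>2) = (\<Sum>y\<in>F'. (cmod (\<xi> (s y)))\<^sup>2)"
    using assms by (intro sum.mono_neutral_cong_right) (auto simp: F'_def s_def push_def)
  also have "\<dots> = (\<Sum>x\<in>s ` F'. (cmod (\<xi> x))\<^sup>2)"
    by (simp add: sum.reindex[OF inj])
  finally have "L2_set (\<lambda>y. cmod (push f \<xi> y)) F = L2_set (\<lambda>x. cmod (\<xi> x)) (s ` F')"
    by (simp add: L2_set_def)
  also have "\<dots> \<le> ell2_norm \<xi>" using fin by (intro L2_set_le_ell2_norm assms) auto
  finally show ?thesis .
qed

lift_definition push_ell2 :: "('a \<Rightarrow> 'b option) \<Rightarrow> 'a ell2 \<Rightarrow> 'b ell2" is push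
  by (blast intro: square_summableI L2_set_push_le)

lift_definition basis_op :: "('a \<Rightarrow> 'b option) \<Rightarrow> 'a ell2 \<Rightarrow>\<^sub>L 'b ell2" is push_ell2
proof (rule bounded_linear_intro[where K = 1])
  fix f :: "'a \<Rightarrow> 'b option" and \<xi> \<eta> and r
  show "push_ell2 f (\<xi> + \<eta>) = push_ell2 f \<xi> + push_ell2 f \<eta>"
    by transfer (auto simp: push_def)
  show "push_ell2 f (r *\<^sub>R \<xi>) = r *\<^sub>R push_ell2 f \<xi>"
    unfolding scaleR_ell2_def by transfer (auto simp: push_def)
  show "norm (push_ell2 f \<xi>) \<le> norm \<xi> * 1"
    by simp (transfer, blast intro: ell2_norm_leI L2_set_push_le)
qed

lemma clinear_basis_op: "clinear_op (basis_op f)"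
  unfolding clinear_op_def by transfer (transfer, auto simp: push_def)

lemma basis_op_ket:
  assumes "\<And>x x' y. f x = Some y \<Longrightarrow> f x' = Some y \<Longrightarrow> x = x'"
  shows "blinfun_apply (basis_op f) (ket x) = (case f x of None \<Rightarrow> 0 | Some y \<Rightarrow> ket y)"
proof -
  have "ell2_coeff (push_ell2 f (ket x)) z = ell2_coeff (case f x of None \<Rightarrow> 0 | Some y \<Rightarrow> ket y) z" for z
  proof (cases "\<exists>x'. f x' = Some z")
    case True
    then have z: "f (SOME x'. f x' = Some z) = Some z" by (rule someI_ex)
    have "(SOME x'. f x' = Some z) = x \<longleftrightarrow> f x = Some z"
      using assms[OF z] z by metis
    then show ?thesis using True
      by (auto simp: push_ell2.rep_eq ket.rep_eq zero_ell2.rep_eq push_def split: option.split)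
  next
    case False
    then show ?thesis
      by (auto simp: push_ell2.rep_eq ket.rep_eq zero_ell2.rep_eq push_def split: option.split)
  qed
  then show ?thesis
    unfolding basis_op.rep_eq by (metis ell2_coeff_inject ext)
qed

datatype letter = La | Lb | La_inv | Lb_inv

primrec letter_inv :: "letter \<Rightarrow> letter" where
  "letter_inv La = La_inv"
| "letter_inv Lb = Lb_inv"
| "letter_inv La_inv = La"
| "letter_inv Lb_inv = Lb"

primrec letter_rot :: "letter \<Rightarrow> letter" where
  "letter_rot La = Lb"
| "letter_rot Lb = La_inv"
| "letter_rot La_inv = Lb_inv"
| "letter_rot Lb_inv = La"

lemma letter_inv_inv [simp]: "letter_inv (letter_inv x) = x"
  by (cases x) auto

lemma letter_inv_eq_iff [simp]: "letter_inv x = letter_inv y \<longleftrightarrow> x = y"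
  by (metis letter_inv_inv)

lemma letter_rot_inv: "letter_rot (letter_inv x) = letter_inv (letter_rot x)"
  by (cases x) auto

lemma letter_rot_eq_iff [simp]: "letter_rot x = letter_rot y \<longleftrightarrow> x = y"
  by (cases x; cases y) auto

definition reduced :: "letter list \<Rightarrow> bool" where
  "reduced = successively (\<lambda>x y. y \<noteq> letter_inv x)"

fun cons_red :: "letter \<Rightarrow> letter list \<Rightarrow> letter list" where
  "cons_red x [] = [x]"
| "cons_red x (y # ys) = (if y = letter_inv x then ys else x # y # ys)"

lemma reduced_Nil [simp]: "reduced []"
  and reduced_single [simp]: "reduced [x]"
  and reduced_Cons_Cons [simp]:
    "reduced (x # y # ys) \<longleftrightarrow> y \<noteq> letter_inv x \<and> reduced (y # ys)"
  by (auto simp: reduced_def)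

lemma reduced_ConsD: "reduced (x # ys) \<Longrightarrow> reduced ys"
  by (cases ys) auto

lemma reduced_cons_red: "reduced ys \<Longrightarrow> reduced (cons_red x ys)"
  by (cases ys) (auto dest: reduced_ConsD)

lemma reduced_foldr: "reduced ys \<Longrightarrow> reduced (foldr cons_red xs ys)"
  by (induction xs) (auto intro: reduced_cons_red)

lemma cons_red_cancel: "reduced ys \<Longrightarrow> cons_red x (cons_red (letter_inv x) ys) = ys"
proof (cases ys)
  case (Cons y zs)
  assume "reduced ys"
  with Cons show ?thesis by (cases zs) auto
qed simp

lemma foldr_cons_red:
  "reduced zs \<Longrightarrow> foldr cons_red (cons_red x ys) zs = cons_red x (foldr cons_red ys zs)"
  by (cases ys) (auto simp: cons_red_cancel reduced_foldr)

lemma foldr_assoc: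
  "reduced zs \<Longrightarrow> foldr cons_red (foldr cons_red xs ys) zs = foldr cons_red xs (foldr cons_red ys zs)"
  by (induction xs) (auto simp: foldr_cons_red)

lemma foldr_reduced: "reduced xs \<Longrightarrow> foldr cons_red xs [] = xs"
proof (induction xs)
  case (Cons x xs)
  then have "foldr cons_red xs [] = xs" by (auto dest: reduced_ConsD)
  with Cons.prems show ?case by (cases xs) auto
qed simp

lemma foldr_left_inverse: "foldr cons_red (map letter_inv (rev xs)) xs = []"
  by (induction xs) auto

lemma reduced_inverse: "reduced xs \<Longrightarrow> reduced (map letter_inv (rev xs))"
  by (auto simp: reduced_def successively_map successively_rev elim!: successively_mono)

lemma reduced_rot: "reduced xs \<Longrightarrow> reduced (map letter_rot xs)"
  by (auto simp: reduced_def successively_map letter_rot_inv[symmetric])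

lemma map_rot_foldr:
  "map letter_rot (foldr cons_red xs ys) = foldr cons_red (map letter_rot xs) (map letter_rot ys)"
proof -
  have "map letter_rot (cons_red x zs) = cons_red (letter_rot x) (map letter_rot zs)" for x zs
    by (cases zs) (auto simp: letter_rot_inv[symmetric])
  then show ?thesis by (induction xs) auto
qed

typedef free2 = "{xs. reduced xs}"
  morphisms word Abs_free2
  by (rule exI[of _ "[]"]) simp

setup_lifting type_definition_free2

instantiation free2 :: "{monoid_mult, inverse}"
begin

lift_definition one_free2 :: free2 is "[]" by simp

lift_definition times_free2 :: "free2 \<Rightarrow> free2 \<Rightarrow> free2" is "foldr cons_red"
  by (rule reduced_foldr)

lift_definition inverse_free2 :: "free2 \<Rightarrow> free2" is "\<lambda>xs. map letter_inv (rev xs)"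
  by (rule reduced_inverse)

definition divide_free2 :: "free2 \<Rightarrow> free2 \<Rightarrow> free2" where
  "divide_free2 x y = x * inverse y"

instance
  by standard (transfer; simp add: foldr_assoc foldr_reduced)+

end

lemma free2_left_inverse [simp]: "inverse x * x = 1" for x :: free2
  by transfer (rule foldr_left_inverse)

lemma inverse_one_free2: "inverse 1 = (1 :: free2)"
  by transfer simp

lift_definition gen_a :: free2 is "[La]" by simp
lift_definition gen_b :: free2 is "[Lb]" by simp

lift_definition alpha_aut :: "free2 \<Rightarrow> free2" is "map letter_rot"
  by (rule reduced_rot)

lemma alpha_aut_mult: "alpha_aut (x * y) = alpha_aut x * alpha_aut y"
  by transfer (rule map_rot_foldr)

lemma alpha_aut_one: "alpha_aut 1 = 1"
  by transfer simp

lemma alpha_aut_a: "alpha_aut gen_a = gen_b"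
  by transfer simp

lemma alpha_aut_b: "alpha_aut gen_b = inverse gen_a"
  by transfer simp

lemma alpha_aut_4: "alpha_aut (alpha_aut (alpha_aut (alpha_aut x))) = x"
proof transfer
  have "letter_rot (letter_rot (letter_rot (letter_rot l))) = l" for l by (cases l) auto
  then show "map letter_rot (map letter_rot (map letter_rot (map letter_rot xs))) = xs" for xs
    by (simp add: o_def)
qed

definition alpha_act :: "4 \<Rightarrow> free2 \<Rightarrow> free2" where
  "alpha_act k = alpha_aut ^^ nat (Rep_bit0 k)"

lemma alpha_act_of_nat: "alpha_act (of_nat n) = alpha_aut ^^ n"
proof -
  have p: "alpha_aut ^^ 4 = id"
    by (simp add: fun_eq_iff eval_nat_numeral alpha_aut_4)
  have "nat (Rep_bit0 (of_nat n :: 4)) = n mod 4"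
    using bit0.Rep_Abs_mod[of "int n", where 'a = "num1 bit0"]
    by (simp add: bit0.of_nat_eq nat_mod_distrib)
  moreover have "alpha_aut ^^ n = alpha_aut ^^ (n mod 4)"
    by (metis p funpow_mod_eq fun_eq_iff id_apply)
  ultimately show ?thesis by (simp add: alpha_act_def)
qed

lemma of_nat_cases4: "\<exists>n. k = of_nat n" for k :: 4
  by (metis bit0_cases of_int_of_nat_eq nonneg_int_cases)

lemma alpha_act_add: "alpha_act (i + j) x = alpha_act i (alpha_act j x)"
proof -
  obtain m n where "i = of_nat m" "j = of_nat n" using of_nat_cases4 by metis
  then show ?thesis by (simp add: alpha_act_of_nat funpow_add flip: of_nat_add)
qed

lemma alpha_act_0 [simp]: "alpha_act 0 x = x"
  using alpha_act_of_nat[of 0] by simp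

lemma alpha_act_1: "alpha_act 1 = alpha_aut"
  using alpha_act_of_nat[of 1] by simp

lemma alpha_act_mult: "alpha_act k (x * y) = alpha_act k x * alpha_act k y"
proof -
  obtain n where n: "k = of_nat n" using of_nat_cases4 by metis
  show ?thesis unfolding n alpha_act_of_nat by (induction n) (auto simp: alpha_aut_mult)
qed

lemma alpha_act_one [simp]: "alpha_act k 1 = 1"
proof -
  obtain n where n: "k = of_nat n" using of_nat_cases4 by metis
  show ?thesis unfolding n alpha_act_of_nat by (induction n) (auto simp: alpha_aut_one)
qed

text \<open>
  The semidirect product: \<open>Grp j w\<close> stands for \<open>\<alpha>\<^sup>j w\<close>, and the multiplication comes from
  \<open>\<alpha>\<^sup>i v \<alpha>\<^sup>j w = \<alpha>\<^sup>i\<^sup>+\<^sup>j (\<alpha>\<^sup>-\<^sup>j v \<alpha>\<^sup>j) w\<close>, where conjugation by \<open>\<alpha>\<^sup>k\<close> acts on the free group as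
  \<open>alpha_act k\<close>.
\<close>

datatype grp = Grp "4" free2

instantiation grp :: "{monoid_mult, inverse}"
begin

definition one_grp :: grp where "1 = Grp 0 1"

definition times_grp :: "grp \<Rightarrow> grp \<Rightarrow> grp" where
  "x * y = (case (x, y) of (Grp i v, Grp j w) \<Rightarrow> Grp (i + j) (alpha_act (- j) v * w))"

definition inverse_grp :: "grp \<Rightarrow> grp" where
  "inverse x = (case x of Grp j w \<Rightarrow> Grp (- j) (alpha_act j (inverse w)))"

definition divide_grp :: "grp \<Rightarrow> grp \<Rightarrow> grp" where
  "divide_grp x y = x * inverse y"

instance
proof
  fix x y z :: grp
  show "x * y * z = x * (y * z)"
  proof (cases x; cases y; cases z)
    fix i j k u v w assume [simp]: "x = Grp i u" "y = Grp j v" "z = Grp k w"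
    have "alpha_act (- k) (alpha_act (- j) u) = alpha_act (- (j + k)) u"
      by (simp add: alpha_act_add[symmetric] add.commute)
    then show ?thesis
      by (simp add: times_grp_def alpha_act_mult mult.assoc add.assoc)
  qed
  show "1 * x = x" "x * 1 = x"
    by (cases x; simp add: times_grp_def one_grp_def)+
qed

end

lemma grp_left_inverse: "inverse x * x = 1" for x :: grp
  by (cases x) (simp add: times_grp_def inverse_grp_def one_grp_def flip: alpha_act_add)

definition of_free2 :: "free2 \<Rightarrow> grp" where
  "of_free2 w = Grp 0 w"

definition alpha :: grp where
  "alpha = Grp 1 1"

lemma of_free2_mult: "of_free2 (v * w) = of_free2 v * of_free2 w"
  by (simp add: of_free2_def times_grp_def)

lemma alpha_conj: "alpha * of_free2 w * inverse alpha = of_free2 (alpha_aut w)"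
  by (simp add: alpha_def of_free2_def times_grp_def inverse_grp_def alpha_act_1 inverse_one_free2 alpha_aut_one)

definition alpha_pow :: "4 \<Rightarrow> grp" where
  "alpha_pow k = Grp k 1"

lemma alpha_pow_of_nat: "alpha ^ n = alpha_pow (of_nat n)"
  by (induction n) (simp_all add: alpha_def alpha_pow_def one_grp_def times_grp_def)

lemma alpha_pow_of_int: "alpha powi n = alpha_pow (of_int n)"
proof (cases "n \<ge> 0")
  case True
  then show ?thesis by (simp add: power_int_def alpha_pow_of_nat)
next
  case False
  have "inverse alpha ^ m = alpha_pow (- of_nat m)" for m
    by (induction m)
       (simp_all add: alpha_def alpha_pow_def one_grp_def times_grp_def inverse_grp_def
          inverse_one_free2)
  with False show ?thesis by (simp add: power_int_def)
qed

lemma alpha_4: "alpha ^ 4 = 1"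
  by (simp add: alpha_pow_of_nat alpha_pow_def one_grp_def)

definition Y_set :: "free2 set" where
  "Y_set = {gen_a powi n * prod_list ws | n ws. set ws \<subseteq> {gen_a, gen_b}}"

typedef Y = Y_set
  morphisms Y_elt Abs_Y
  unfolding Y_set_def by (rule exI[of _ 1]) (auto intro!: exI[of _ 0] exI[of _ "[]"])

definition partial_translation :: "free2 \<Rightarrow> Y \<Rightarrow> Y option" where
  "partial_translation g y =
     (if Y_elt y * g \<in> Y_set then Some (Abs_Y (Y_elt y * g)) else None)"

definition partial_translation_op :: "free2 \<Rightarrow> (Y ell2 \<Rightarrow>\<^sub>L Y ell2)" where
  "partial_translation_op g = basis_op (partial_translation g)"

definition partial_translation_algebra :: "(Y ell2 \<Rightarrow>\<^sub>L Y ell2) set" where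
  "partial_translation_algebra = cstar_subalgebra hull range partial_translation_op"

lemma foldr_reduced_append: "reduced (xs @ ys) \<Longrightarrow> foldr cons_red xs ys = xs @ ys"
proof (induction xs)
  case (Cons x xs)
  then have "foldr cons_red xs ys = xs @ ys" by (auto dest: reduced_ConsD)
  with Cons.prems show ?case by (cases "xs @ ys") auto
qed simp

lift_definition letter_elt :: "letter \<Rightarrow> free2" is "\<lambda>l. [l]" by simp

definition of_letters :: "letter list \<Rightarrow> free2" where
  "of_letters xs = prod_list (map letter_elt xs)"

lemma of_letters_Nil [simp]: "of_letters [] = 1"
  and of_letters_Cons: "of_letters (x # xs) = letter_elt x * of_letters xs"
  and of_letters_append: "of_letters (xs @ ys) = of_letters xs * of_letters ys"
  by (simp_all add: of_letters_def)

lemma word_of_letters: "reduced xs \<Longrightarrow> word (of_letters xs) = xs"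
proof (induction xs)
  case (Cons x xs)
  then have "word (of_letters xs) = xs" by (auto dest: reduced_ConsD)
  then show ?case using foldr_reduced_append[of "[x]" xs] Cons.prems
    by (simp add: of_letters_Cons times_free2.rep_eq letter_elt.rep_eq)
qed (simp add: one_free2.rep_eq)

lemma of_letters_word: "of_letters (word x) = x"
  using word[of x] by (simp add: word_of_letters flip: word_inject)

lemma reduced_word: "reduced (word x)"
  using word[of x] by simp

lemma gen_a_eq: "gen_a = letter_elt La" and gen_b_eq: "gen_b = letter_elt Lb"
  by (transfer, simp)+

lemma inverse_letter: "inverse (letter_elt l) = letter_elt (letter_inv l)"
  by transfer simp

lemma letter_inv_mult: "letter_elt (letter_inv l) * letter_elt l = 1"
  by (metis inverse_letter free2_left_inverse)

lemma letter_mult_inv: "letter_elt l * letter_elt (letter_inv l) = 1"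
  by (metis letter_inv_mult letter_inv_inv)

lemma free2_right_inverse [simp]: "x * inverse x = 1" for x :: free2
  by (metis free2_left_inverse mult.assoc mult_1_left)

lemma free2_inverse_inverse: "inverse (inverse x) = x" for x :: free2
  by (metis free2_left_inverse mult.assoc mult_1_left mult_1_right)

definition Y_word :: "letter list \<Rightarrow> bool" where
  "Y_word xs \<longleftrightarrow> (\<exists>n ps. set ps \<subseteq> {La, Lb} \<and> xs = replicate n La_inv @ ps)"

lemma reduced_positive: "set ps \<subseteq> {La, Lb} \<Longrightarrow> reduced ps"
proof (induction ps)
  case (Cons p ps)
  then show ?case by (cases ps) auto
qed simp

lemma reduced_negative: "reduced (replicate n La_inv)"
proof (induction n)
  case (Suc n)
  then show ?case by (cases n) auto
qed simp

lemma of_letters_replicate: "of_letters (replicate n l) = letter_elt l ^ n"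
  by (induction n) (simp_all add: of_letters_Cons)

lemma positive_list:
  "set ws \<subseteq> {gen_a, gen_b} \<Longrightarrow> \<exists>ps. set ps \<subseteq> {La, Lb} \<and> prod_list ws = of_letters ps"
proof (induction ws)
  case Nil
  then show ?case by (intro exI[of _ "[]"]) simp
next
  case (Cons w ws)
  then obtain ps where ps: "set ps \<subseteq> {La, Lb}" "prod_list ws = of_letters ps" by auto
  obtain l where l: "l \<in> {La, Lb}" "w = letter_elt l"
    using Cons.prems by (auto simp: gen_a_eq gen_b_eq)
  show ?case using ps l by (intro exI[of _ "l # ps"]) (auto simp: of_letters_Cons)
qed

lemma Y_set_iff: "y \<in> Y_set \<longleftrightarrow> Y_word (word y)"
proof
  assume "Y_word (word y)"
  then obtain n ps where ps: "set ps \<subseteq> {La, Lb}" "word y = replicate n La_inv @ ps"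
    unfolding Y_word_def by auto
  have "y = letter_elt La_inv ^ n * of_letters ps"
    by (metis ps(2) of_letters_word of_letters_append of_letters_replicate)
  also have "letter_elt La_inv ^ n = gen_a powi (- int n)"
    by (auto simp: power_int_def gen_a_eq inverse_letter inverse_one_free2)
  finally show "y \<in> Y_set"
    unfolding Y_set_def of_letters_def using ps(1)
    by (auto simp: gen_a_eq gen_b_eq intro!: exI[of _ "- int n"] exI[of _ "map letter_elt ps"])
next
  assume "y \<in> Y_set"
  then obtain n ws where ws: "set ws \<subseteq> {gen_a, gen_b}" "y = gen_a powi n * prod_list ws"
    unfolding Y_set_def by auto
  then obtain ps where ps: "set ps \<subseteq> {La, Lb}" "prod_list ws = of_letters ps"
    using positive_list by blast
  have neg: "Y_word (word (letter_elt La_inv ^ m * of_letters ps))" for m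
  proof (induction m)
    case 0
    then show ?case using ps(1) by (auto simp: Y_word_def word_of_letters reduced_positive intro: exI[of _ 0])
  next
    case (Suc m)
    let ?z = "letter_elt La_inv ^ m * of_letters ps"
    from Suc obtain n qs where qs: "set qs \<subseteq> {La, Lb}" "word ?z = replicate n La_inv @ qs"
      by (auto simp: Y_word_def)
    have w: "word (letter_elt La_inv ^ Suc m * of_letters ps) = cons_red La_inv (word ?z)"
      by (simp add: mult.assoc times_free2.rep_eq letter_elt.rep_eq)
    show ?case
    proof (cases "n = 0 \<and> (\<exists>rs. qs = La # rs)")
      case True
      then obtain rs where "qs = La # rs" "n = 0" by auto
      with qs show ?thesis unfolding w Y_word_def by (intro exI[of _ 0] exI[of _ rs]) auto
    next
      case False
      have "cons_red La_inv (word ?z) = replicate (Suc n) La_inv @ qs"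
      proof (cases n)
        case 0
        with False qs show ?thesis by (cases qs) auto
      next
        case (Suc k)
        with qs show ?thesis by simp
      qed
      then show ?thesis using qs(1) unfolding w Y_word_def by blast
    qed
  qed
  show "Y_word (word y)"
  proof (cases "n \<ge> 0")
    case True
    then have "y = of_letters (replicate (nat n) La @ ps)"
      by (simp add: ws(2) ps(2) power_int_def of_letters_append of_letters_replicate gen_a_eq)
    moreover have p: "set (replicate (nat n) La @ ps) \<subseteq> {La, Lb}" using ps(1) by auto
    ultimately show ?thesis
      unfolding Y_word_def by (metis append_Nil replicate_0 reduced_positive word_of_letters)
  next
    case False
    then show ?thesis using neg[of "nat (- n)"]
      by (simp add: ws(2) ps(2) power_int_def gen_a_eq inverse_letter)
  qed
qed

lemma Y_word_prefix:
  assumes "Y_word (p @ q)"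
  shows "Y_word p"
proof -
  obtain n ps where ps: "set ps \<subseteq> {La, Lb}" "p @ q = replicate n La_inv @ ps"
    using assms by (auto simp: Y_word_def)
  have "p = take (length p) (replicate n La_inv @ ps)" by (metis append_eq_conv_conj ps(2))
  also have "\<dots> = replicate (min (length p) n) La_inv @ take (length p - n) ps"
    by (simp add: min.commute)
  finally show ?thesis
    unfolding Y_word_def using ps(1) set_take_subset by (metis order_trans)
qed

lemma Y_word_snoc:
  assumes "Y_word xs"
  shows "Y_word (xs @ [La])" "Y_word (xs @ [Lb])" "\<not> Y_word (xs @ [Lb_inv])"
    "Y_word (xs @ [La_inv]) \<longleftrightarrow> set xs \<subseteq> {La_inv}"
proof -
  obtain n ps where ps: "set ps \<subseteq> {La, Lb}" "xs = replicate n La_inv @ ps"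
    using assms by (auto simp: Y_word_def)
  have "set (ps @ [l]) \<subseteq> {La, Lb}" if "l \<in> {La, Lb}" for l using ps(1) that by auto
  then show "Y_word (xs @ [La])" "Y_word (xs @ [Lb])"
    unfolding Y_word_def ps(2) append_assoc by blast+
  have "set zs \<subseteq> {La_inv, La, Lb}" if "Y_word zs" for zs
    using that by (auto simp: Y_word_def)
  from this[of "xs @ [Lb_inv]"] show "\<not> Y_word (xs @ [Lb_inv])" by auto
  show "Y_word (xs @ [La_inv]) \<longleftrightarrow> set xs \<subseteq> {La_inv}"
  proof
    assume "Y_word (xs @ [La_inv])"
    then obtain m qs where qs: "set qs \<subseteq> {La, Lb}" "xs @ [La_inv] = replicate m La_inv @ qs"
      by (auto simp: Y_word_def)
    have "qs = []"
    proof (rule ccontr)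
      assume "qs \<noteq> []"
      then have "last qs = La_inv" using arg_cong[OF qs(2), of last] by simp
      with \<open>qs \<noteq> []\<close> have "La_inv \<in> set qs" by (metis last_in_set)
      with qs(1) show False by auto
    qed
    with qs(2) have "set (xs @ [La_inv]) \<subseteq> {La_inv}" by auto
    then show "set xs \<subseteq> {La_inv}" by simp
  next
    assume "set xs \<subseteq> {La_inv}"
    then have "xs @ [La_inv] = replicate (Suc (length xs)) La_inv @ []"
      by (simp add: replicate_append_same[symmetric] replicate_eqI subset_eq)
    then show "Y_word (xs @ [La_inv])" unfolding Y_word_def by (metis empty_subsetI list.set(1))
  qed
qed

lemma word_snoc:
  assumes "reduced (word y @ l # xs)"
  shows "word (y * letter_elt l * of_letters xs) = word y @ l # xs"
  using word_of_letters[OF assms] by (simp add: of_letters_append of_letters_Cons of_letters_word mult.assoc)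

lemma word_snoc_cancel:
  assumes "word y = p @ [letter_inv l]"
  shows "word (y * letter_elt l) = p"
proof -
  have "y = of_letters p * letter_elt (letter_inv l)"
    by (metis assms of_letters_word of_letters_append of_letters_Cons of_letters_Nil mult_1_right)
  then have "y * letter_elt l = of_letters p" by (simp add: mult.assoc letter_inv_mult)
  moreover have "reduced p"
    using reduced_word[of y] assms by (auto simp: reduced_def successively_append_iff)
  ultimately show ?thesis by (simp add: word_of_letters)
qed

lemma reduced_snocI:
  assumes "reduced (l # xs)" "\<And>p. word y \<noteq> p @ [letter_inv l]"
  shows "reduced (word y @ l # xs)"
proof -
  have "l \<noteq> letter_inv (last (word y))" if "word y \<noteq> []"
    using assms(2)[of "butlast (word y)"] that by (metis append_butlast_last_id letter_inv_inv)
  with assms(1) reduced_word[of y] show ?thesis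
    by (auto simp: reduced_def successively_append_iff)
qed

lemma Y_set_convex:
  assumes "y \<in> Y_set" "reduced (l # xs)" "y * letter_elt l * of_letters xs \<in> Y_set"
  shows "y * letter_elt l \<in> Y_set"
proof (cases "\<exists>p. word y = p @ [letter_inv l]")
  case True
  then show ?thesis using assms(1) by (metis Y_set_iff Y_word_prefix word_snoc_cancel)
next
  case False
  then have "reduced (word y @ l # xs)" using assms(2) by (intro reduced_snocI) auto
  then have "Y_word ((word y @ [l]) @ xs)" using assms(3) by (simp add: Y_set_iff word_snoc)
  then have "Y_word (word y @ [l])" by (rule Y_word_prefix)
  moreover have "word (y * letter_elt l) = word y @ [l]"
    using word_snoc[of y l "[]"] False reduced_snocI[of l "[]" y] by auto
  ultimately show ?thesis by (simp add: Y_set_iff)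
qed

lemma Y_set_right_a: "y \<in> Y_set \<Longrightarrow> y * gen_a \<in> Y_set"
  and Y_set_right_b: "y \<in> Y_set \<Longrightarrow> y * gen_b \<in> Y_set"
proof -
  have "y * letter_elt l \<in> Y_set" if "y \<in> Y_set" "l \<in> {La, Lb}" for l
  proof (cases "\<exists>p. word y = p @ [letter_inv l]")
    case True
    then show ?thesis using that by (metis Y_set_iff Y_word_prefix word_snoc_cancel)
  next
    case False
    then have "word (y * letter_elt l) = word y @ [l]"
      using word_snoc[of y l "[]"] reduced_snocI[of l "[]" y] by auto
    then show ?thesis using that Y_word_snoc[of "word y"] by (auto simp: Y_set_iff)
  qed
  then show "y \<in> Y_set \<Longrightarrow> y * gen_a \<in> Y_set" "y \<in> Y_set \<Longrightarrow> y * gen_b \<in> Y_set"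
    by (auto simp: gen_a_eq gen_b_eq)
qed

lemma Y_set_last:
  assumes "y \<in> Y_set"
  shows "y * inverse gen_b \<in> Y_set \<longleftrightarrow> y * inverse gen_a \<notin> Y_set"
proof -
  have *: "word (y * letter_elt (letter_inv l)) = (if p = [] \<or> last p \<noteq> l then p @ [letter_inv l] else butlast p)"
    if "word y = p" for l p
  proof (cases "p = [] \<or> last p \<noteq> l")
    case True
    then have "reduced (word y @ [letter_inv l])"
      using that by (intro reduced_snocI) auto
    with True show ?thesis
      using that word_snoc[of y "letter_inv l" "[]"] by simp
  next
    case False
    then show ?thesis using that word_snoc_cancel[of y "butlast p" "letter_inv l"] by auto
  qed
  note Y = assms[unfolded Y_set_iff]
  have eq: "inverse gen_a = letter_elt (letter_inv La)" "inverse gen_b = letter_elt (letter_inv Lb)"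
    by (simp_all only: gen_a_eq gen_b_eq inverse_letter)
  obtain n ps where ps: "set ps \<subseteq> {La, Lb}" "word y = replicate n La_inv @ ps"
    using Y by (auto simp: Y_word_def)
  have pre: "Y_word (butlast (word y))"
    using Y Y_word_prefix[of "butlast (word y)" "[last (word y)]"] by (cases "word y = []") auto
  show ?thesis
  proof (cases "ps = []")
    case True
    then have "set (word y) \<subseteq> {La_inv}" using ps by auto
    moreover from this have "last (word y) = La_inv" if "word y \<noteq> []" using that last_in_set by blast
    ultimately show ?thesis
      unfolding eq Y_set_iff *[OF refl] using Y_word_snoc[OF Y] by auto
  next
    case False
    then have "last ps \<in> {La, Lb}" using ps(1) last_in_set by blast
    then have l: "last (word y) \<in> {La, Lb}" "last (word y) \<in> set (word y)" "word y \<noteq> []"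
      using ps False by auto
    then have "\<not> set (word y) \<subseteq> {La_inv}"
      by (metis insertE empty_iff letter.distinct subset_eq)
    with l show ?thesis
      unfolding eq Y_set_iff *[OF refl] using Y_word_snoc[OF Y] pre by auto
  qed
qed

lemma op_eqI:
  fixes S T :: "'a ell2 \<Rightarrow>\<^sub>L 'b ell2"
  assumes "clinear_op S" "clinear_op T" "\<And>x. blinfun_apply S (ket x) = blinfun_apply T (ket x)"
  shows "S = T"
proof (rule blinfun_eqI)
  fix f
  have "((\<lambda>x. ell2_coeff f x *\<^sub>C blinfun_apply R (ket x)) has_sum blinfun_apply R f) UNIV"
    if "clinear_op R" for R :: "'a ell2 \<Rightarrow>\<^sub>L 'b ell2"
    using has_sum_bounded_linear[OF blinfun.bounded_linear_right has_sum_ket[of f], of R] that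
    by (simp add: o_def clinear_op_def)
  from this[OF assms(1)] this[OF assms(2)] show "blinfun_apply S f = blinfun_apply T f"
    using assms(3) by (simp add: has_sum_unique)
qed

lemma ell2_eqI: "(\<And>x. cinner (ket x) f = cinner (ket x) g) \<Longrightarrow> f = g"
  unfolding cinner_ket_left by (metis ell2_coeff_inject ext)

lemma clinear_adj:
  assumes "clinear_op T"
  shows "clinear_op (adj T)"
  unfolding clinear_op_def
  by (auto intro!: ell2_eqI simp: cinner_adj[OF assms, symmetric] cinner_scaleC_right)

lemma clinear_compose: "clinear_op S \<Longrightarrow> clinear_op T \<Longrightarrow> clinear_op (S o\<^sub>L T)"
  by (simp add: clinear_op_def)

lemma clinear_plus: "clinear_op S \<Longrightarrow> clinear_op T \<Longrightarrow> clinear_op (S + T)"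
  by (simp add: clinear_op_def blinfun.add_left linear_add[OF bounded_linear.linear[OF bounded_linear_scaleC]])

lemma clinear_id: "clinear_op id_blinfun"
  by (simp add: clinear_op_def)

lemma clinear_partial_translation_op: "clinear_op (partial_translation_op g)"
  unfolding partial_translation_op_def by (rule clinear_basis_op)

lemma free2_right_cancel: "x * g = x' * g \<longleftrightarrow> x = x'" for x g :: free2
  by (metis free2_right_inverse mult.assoc mult_1_right)

lemma partial_translation_op_ket:
  "blinfun_apply (partial_translation_op g) (ket y) =
     (if Y_elt y * g \<in> Y_set then ket (Abs_Y (Y_elt y * g)) else 0)"
  unfolding partial_translation_op_def
  by (subst basis_op_ket)
     (auto simp: partial_translation_def Abs_Y_inject free2_right_cancel Y_elt_inject split: if_splits)

lemma adj_partial_translation_op: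
  "adj (partial_translation_op g) = partial_translation_op (inverse g)"
proof (rule op_eqI)
  fix y
  have "ell2_coeff (blinfun_apply (adj (partial_translation_op g)) (ket y)) x =
        ell2_coeff (blinfun_apply (partial_translation_op (inverse g)) (ket y)) x" for x
  proof -
    have "ell2_coeff (blinfun_apply (adj (partial_translation_op g)) (ket y)) x =
          cinner (blinfun_apply (partial_translation_op g) (ket x)) (ket y)"
      by (simp add: cinner_adj[OF clinear_partial_translation_op] cinner_ket_left)
    also have "\<dots> = (if Y_elt x * g = Y_elt y then 1 else 0)"
    proof -
      have "cinner 0 f = 0" for f :: "Y ell2"
        by (simp add: cinner_def zero_ell2.rep_eq)
      then show ?thesis using Y_elt[of y]
        by (auto simp: partial_translation_op_ket cinner_ket_left ket.rep_eq Abs_Y_inverse Y_elt_inverse)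
    qed
    also have "Y_elt x * g = Y_elt y \<longleftrightarrow> Y_elt x = Y_elt y * inverse g"
      by (metis free2_left_inverse free2_right_inverse mult.assoc mult_1_right)
    also have "(if \<dots> then 1 else 0) =
        ell2_coeff (blinfun_apply (partial_translation_op (inverse g)) (ket y)) x"
    proof -
      have "x = Abs_Y z \<longleftrightarrow> Y_elt x = z" if "z \<in> Y_set" for z
        using that by (auto simp: Abs_Y_inverse Y_elt_inverse)
      then show ?thesis using Y_elt[of x]
        by (auto simp: partial_translation_op_ket ket.rep_eq zero_ell2.rep_eq)
    qed
    finally show ?thesis .
  qed
  then show "blinfun_apply (adj (partial_translation_op g)) (ket y) =
        blinfun_apply (partial_translation_op (inverse g)) (ket y)"
    by (metis ell2_coeff_inject ext)
qed (auto intro: clinear_adj clinear_partial_translation_op)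

text \<open>
  The partial translation algebra is a copy of the Cuntz algebra \<open>\<O>\<^sub>2\<close>: it is generated by
  two isometries satisfying the Cuntz relation.
\<close>

lemma cuntz_isometries:
  shows "adj (partial_translation_op gen_a) o\<^sub>L partial_translation_op gen_a = id_blinfun"
    and "adj (partial_translation_op gen_b) o\<^sub>L partial_translation_op gen_b = id_blinfun"
proof -
  have "partial_translation_op (inverse g) o\<^sub>L partial_translation_op g = id_blinfun"
    if "\<And>y. y \<in> Y_set \<Longrightarrow> y * g \<in> Y_set" for g
    by (rule op_eqI)
       (use that Y_elt in \<open>auto intro!: clinear_compose clinear_partial_translation_op clinear_id
         simp: partial_translation_op_ket Abs_Y_inverse Y_elt_inverse mult.assoc\<close>)
  from this[OF Y_set_right_a] this[OF Y_set_right_b]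
  show "adj (partial_translation_op gen_a) o\<^sub>L partial_translation_op gen_a = id_blinfun"
    and "adj (partial_translation_op gen_b) o\<^sub>L partial_translation_op gen_b = id_blinfun"
    by (simp_all add: adj_partial_translation_op)
qed

lemma cuntz_relation:
  "(partial_translation_op gen_a o\<^sub>L adj (partial_translation_op gen_a)) +
   (partial_translation_op gen_b o\<^sub>L adj (partial_translation_op gen_b)) = id_blinfun"
  unfolding adj_partial_translation_op
proof (rule op_eqI)
  fix y
  have *: "blinfun_apply (partial_translation_op g o\<^sub>L partial_translation_op (inverse g)) (ket y) =
           (if Y_elt y * inverse g \<in> Y_set then ket y else 0)" for g
    using Y_elt[of y]
    by (auto simp: partial_translation_op_ket Abs_Y_inverse Y_elt_inverse mult.assoc blinfun.zero_right)
  show "blinfun_apply ((partial_translation_op gen_a o\<^sub>L partial_translation_op (inverse gen_a)) +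
          (partial_translation_op gen_b o\<^sub>L partial_translation_op (inverse gen_b))) (ket y) =
        blinfun_apply id_blinfun (ket y)"
    unfolding blinfun.add_left * using Y_set_last[OF Y_elt[of y]] by simp
qed (intro clinear_plus clinear_compose clinear_partial_translation_op clinear_id)+

lemma partial_translation_op_Cons:
  assumes "reduced (l # xs)"
  shows "partial_translation_op (letter_elt l * of_letters xs) =
         partial_translation_op (of_letters xs) o\<^sub>L partial_translation_op (letter_elt l)"
proof (rule op_eqI)
  fix y
  show "blinfun_apply (partial_translation_op (letter_elt l * of_letters xs)) (ket y) =
        blinfun_apply (partial_translation_op (of_letters xs) o\<^sub>L partial_translation_op (letter_elt l)) (ket y)"
    using Y_set_convex[OF Y_elt[of y] assms]
    by (auto simp: partial_translation_op_ket Abs_Y_inverse mult.assoc blinfun.zero_right)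
qed (intro clinear_compose clinear_partial_translation_op)+

lemma partial_translation_algebra_generators:
  "partial_translation_algebra =
     cstar_subalgebra hull {partial_translation_op gen_a, partial_translation_op gen_b}"
proof -
  have "partial_translation_op g \<in> A"
    if A: "cstar_subalgebra A"
      and ab: "partial_translation_op gen_a \<in> A" "partial_translation_op gen_b \<in> A" for A g
  proof -
    have adj: "partial_translation_op (inverse g) \<in> A" if "partial_translation_op g \<in> A" for g
      using A that by (metis cstar_subalgebra_def adj_partial_translation_op)
    have comp: "S o\<^sub>L T \<in> A" if "S \<in> A" "T \<in> A" for S T
      using A that by (simp add: cstar_subalgebra_def)
    have letter: "partial_translation_op (letter_elt l) \<in> A" for l
      using ab adj[OF ab(1)] adj[OF ab(2)]
      by (cases l) (simp_all add: gen_a_eq gen_b_eq inverse_letter)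
    have "partial_translation_op 1 = id_blinfun"
      by (rule op_eqI)
         (use Y_elt in \<open>auto intro: clinear_partial_translation_op clinear_id
           simp: partial_translation_op_ket Y_elt_inverse\<close>)
    then have one: "partial_translation_op 1 \<in> A"
      using comp[OF adj[OF ab(1)] ab(1)] cuntz_isometries(1)
      by (simp add: adj_partial_translation_op)
    have "partial_translation_op (of_letters xs) \<in> A" if "reduced xs" for xs
      using that
    proof (induction xs)
      case (Cons l xs)
      then show ?case
        using reduced_ConsD comp letter by (metis of_letters_Cons partial_translation_op_Cons)
    qed (simp add: one)
    from this[OF reduced_word[of g]] show ?thesis by (simp add: of_letters_word)
  qed
  then have "{A. cstar_subalgebra A \<and> range partial_translation_op \<subseteq> A} =
    {A. cstar_subalgebra A \<and> {partial_translation_op gen_a, partial_translation_op gen_b} \<subseteq> A}"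
    by auto
  then show ?thesis by (simp add: partial_translation_algebra_def hull_def)
qed

text \<open>
  Since \<open>G\<close> is the disjoint union of the cosets \<open>\<alpha>\<^sup>j F\<^sub>2\<close>, right multiplication by \<open>g \<in> F\<^sub>2\<close> on
  \<open>\<ell>\<^sup>2(G) \<cong> \<ell>\<^sup>2(F\<^sub>2) \<otimes> \<ell>\<^sup>2(H)\<close> is \<open>\<rho>(g) \<otimes> 1\<close> (up to \<open>g \<leftrightarrow> g\<^sup>-\<^sup>1\<close>), so the algebra below is
  \<open>C\<^sup>*\<^sub>\<rho>(F\<^sub>2) \<otimes> 1\<close>.
\<close>

definition right_mult_op :: "free2 \<Rightarrow> (grp ell2 \<Rightarrow>\<^sub>L grp ell2)" where
  "right_mult_op g = basis_op (\<lambda>x. Some (x * of_free2 g))"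

definition right_regular_algebra :: "(grp ell2 \<Rightarrow>\<^sub>L grp ell2) set" where
  "right_regular_algebra = cstar_subalgebra hull range right_mult_op"

text \<open>The triple \<open>(n, is, k)\<close> encodes the normal form with \<open>is = [i\<^sub>0, \<dots>]\<close> of length \<open>d\<close> and
  \<open>k = i\<^sub>d\<close> in \<open>\<int>/4\<int>\<close>.\<close>

definition nf_admissible :: "nat \<times> int list \<times> 4 \<Rightarrow> bool" where
  "nf_admissible = (\<lambda>(n, is, k). set is \<subseteq> {-1, 0, 1} \<and> (n > 0 \<and> is \<noteq> [] \<longrightarrow> hd is \<noteq> 0))"

definition nf_value :: "nat \<times> int list \<times> 4 \<Rightarrow> grp" where
  "nf_value = (\<lambda>(n, is, k). inverse (of_free2 gen_a) ^ n *
     prod_list (map (\<lambda>i. alpha powi i * of_free2 gen_a) is) * alpha_pow k)"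

definition normal_form :: "grp \<Rightarrow> nat \<times> int list \<times> 4" where
  "normal_form x = (THE t. nf_admissible t \<and> nf_value t = x)"

definition nf_h :: "grp \<Rightarrow> 4" where
  "nf_h x = (case normal_form x of (n, is, k) \<Rightarrow> - k)"

text \<open>Only the arguments \<open>0\<close>, \<open>1\<close>, \<open>-1\<close> are relevant.\<close>

definition u_elt :: "int \<Rightarrow> free2" where
  "u_elt i = (if i = 0 then gen_a else if i = 1 then gen_b ^ 2 else gen_a * gen_b)"

definition v_elt :: "4 \<Rightarrow> free2" where
  "v_elt k = (if k = 0 then gen_a ^ 2 else if k = 1 then gen_b ^ 2
              else if k = 2 then gen_a * gen_b else gen_b * gen_a)"

definition Phi :: "grp \<Rightarrow> Y" where
  "Phi x = Abs_Y (case normal_form x of (n, is, k) \<Rightarrow>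
     inverse gen_a ^ n * prod_list (map u_elt is) * v_elt (nf_h x))"

definition U_op :: "grp ell2 \<Rightarrow>\<^sub>L Y ell2" where
  "U_op = basis_op (\<lambda>x. Some (Phi x))"

definition Phi_star :: "(grp ell2 \<Rightarrow>\<^sub>L grp ell2) \<Rightarrow> (Y ell2 \<Rightarrow>\<^sub>L Y ell2)" where
  "Phi_star T = U_op o\<^sub>L T o\<^sub>L adj U_op"

end

theory Submission
  imports Defs
begin

text \<open>The group \<open>G\<close> is generated by \<open>\<alpha>\<close> and \<open>a\<close>, so it suffices that \<open>\<Phi>\<^sub>*\<close> maps the right multiplications
  by \<open>\<alpha>\<close> and by \<open>a\<close> into \<open>C\<^sup>*(Y)\<close>. In normal form both act only on the last one or two exponents;
  on \<open>Y\<close> this becomes a finite table of replacements of a positive suffix \<open>w\<close> by a positive word \<open>w'\<close>.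
  Such a replacement, extended by \<open>0\<close> to the elements without suffix \<open>w\<close>, is a product of two partial
  translations. The table is exhaustive and unambiguous because the \<open>v\<^sub>k\<close>, and likewise the \<open>u\<^sub>i\<close>,
  form a complete suffix code.\<close>

subsection \<open>Normal forms in \<open>G\<close>\<close>

lemma four_cases: "k = 0 \<or> k = 1 \<or> k = 2 \<or> k = 3" for k :: 4
  using exhaust_4[of k] by auto

text \<open>The image of \<open>a\<close> under the \<open>s\<close>-th power of \<alpha>; in this
  indexing inversion is the shift by 2.\<close>

definition rot_letter :: "4 \<Rightarrow> letter" where
  "rot_letter s = (if s = 0 then La else if s = 1 then Lb else if s = 2 then La_inv else Lb_inv)"

lemma rot_letter_inject: "rot_letter s = rot_letter t \<longleftrightarrow> s = t"
  using four_cases[of s] four_cases[of t] by (auto simp: rot_letter_def)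

lemma letter_inv_rot_letter: "letter_inv (rot_letter s) = rot_letter (s + 2)"
  using four_cases[of s] by (auto simp: rot_letter_def)

lemma rot_letter_surj: "\<exists>s. l = rot_letter s"
proof (cases l)
  case La
  then show ?thesis by (intro exI[of _ 0]) (simp add: rot_letter_def)
next
  case Lb
  then show ?thesis by (intro exI[of _ 1]) (simp add: rot_letter_def)
next
  case La_inv
  then show ?thesis by (intro exI[of _ 2]) (simp add: rot_letter_def)
next
  case Lb_inv
  then show ?thesis by (intro exI[of _ 3]) (simp add: rot_letter_def)
qed

lemma alpha_act_gen_a: "alpha_act s gen_a = letter_elt (rot_letter s)"
proof -
  have "alpha_aut (letter_elt l) = letter_elt (letter_rot l)" for l
    by transfer simp
  moreover have "alpha_act 2 gen_a = alpha_act 1 (alpha_act 1 gen_a)"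
    "alpha_act 3 gen_a = alpha_act 1 (alpha_act 1 (alpha_act 1 gen_a))"
    by (simp_all flip: alpha_act_add)
  ultimately show ?thesis
    using four_cases[of s] by (auto simp: alpha_act_1 gen_a_eq rot_letter_def)
qed

lemma alpha_pow_of_free2: "alpha_pow s * of_free2 w = of_free2 (alpha_act s w) * alpha_pow s"
  by (simp add: alpha_pow_def of_free2_def times_grp_def flip: alpha_act_add)

lemma alpha_pow_add: "alpha_pow i * alpha_pow j = alpha_pow (i + j)"
  by (simp add: alpha_pow_def times_grp_def)

lemma of_free2_alpha_pow: "of_free2 w * alpha_pow k = Grp k (alpha_act (- k) w)"
  by (simp add: alpha_pow_def of_free2_def times_grp_def)

lemma of_free2_one: "of_free2 1 = 1"
  by (simp add: of_free2_def one_grp_def)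

lemma inverse_of_free2: "inverse (of_free2 w) = of_free2 (inverse w)"
  by (simp add: of_free2_def inverse_grp_def)

text \<open>Pushing all powers of \<open>\<alpha>\<close> to the right turns \<open>\<alpha>\<^sup>s \<alpha>\<^bsup>i\<^sub>0\<^esup> a \<alpha>\<^bsup>i\<^sub>1\<^esup> a \<dots>\<close>
  into a word whose letters are the images of \<open>a\<close> under the partial sums of the exponents; since these exponents avoid
  \<open>2\<close>, the word is reduced.\<close>

fun rot_path :: "4 \<Rightarrow> int list \<Rightarrow> letter list" where
  "rot_path s [] = []"
| "rot_path s (i # is) = rot_letter (s + of_int i) # rot_path (s + of_int i) is"

lemma alpha_pow_prod_list:
  "alpha_pow s * prod_list (map (\<lambda>i. alpha powi i * of_free2 gen_a) is) =
     of_free2 (of_letters (rot_path s is)) * alpha_pow (s + of_int (sum_list is))"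
proof (induction "is" arbitrary: s)
  case (Cons i "is")
  let ?t = "s + of_int i"
  have "alpha_pow s * (alpha_pow (of_int i) * of_free2 gen_a) = of_free2 (letter_elt (rot_letter ?t)) * alpha_pow ?t"
    by (metis mult.assoc alpha_pow_add alpha_pow_of_free2 alpha_act_gen_a)
  then show ?case
    using Cons[of ?t]
    by (simp add: alpha_pow_of_int of_letters_Cons of_free2_mult mult.assoc add.assoc)
       (metis mult.assoc)
qed (simp add: of_free2_one)

text \<open>The rewriting collects the powers of \<alpha> on the right, while \<open>Grp j w\<close>
  has them on the left; the change of side twists the word by the inverse total exponent.\<close>

lemma nf_value_eq:
  "nf_value (n, is, k) = Grp (of_int (sum_list is) + k)
     (alpha_act (- (of_int (sum_list is) + k)) (of_letters (replicate n La_inv @ rot_path 0 is)))"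
proof -
  have "inverse (of_free2 gen_a) ^ n = of_free2 (of_letters (replicate n La_inv))"
    by (induction n)
       (simp_all add: of_free2_one of_letters_Cons of_free2_mult inverse_of_free2 gen_a_eq inverse_letter)
  moreover have "alpha_pow 0 = 1" by (simp add: alpha_pow_def one_grp_def)
  ultimately have "nf_value (n, is, k) = of_free2 (of_letters (replicate n La_inv @ rot_path 0 is)) *
      alpha_pow (of_int (sum_list is) + k)"
    using alpha_pow_prod_list[of 0 "is"]
    by (simp add: nf_value_def of_letters_append of_free2_mult mult.assoc flip: alpha_pow_add)
  then show ?thesis by (simp add: of_free2_alpha_pow)
qed

lemma small_int_4_inject:
  "i \<in> {-1, 0, 1} \<Longrightarrow> j \<in> {-1, 0, 1} \<Longrightarrow> of_int i = (of_int j :: 4) \<longleftrightarrow> i = j"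
  by auto

lemma small_int_4_cases:
  assumes "k \<noteq> (2 :: 4)"
  obtains i where "i \<in> {-1, 0, 1}" "k = of_int i"
  using four_cases[of k] assms that[of 0] that[of 1] that[of "-1"] by auto

lemma rot_path_inject:
  "set is \<subseteq> {-1, 0, 1} \<Longrightarrow> set js \<subseteq> {-1, 0, 1} \<Longrightarrow> rot_path s is = rot_path s js \<Longrightarrow> is = js"
proof (induction "is" arbitrary: s js)
  case Nil
  then show ?case by (cases js) auto
next
  case (Cons i "is")
  then obtain j js' where [simp]: "js = j # js'" by (cases js) auto
  have "of_int i = (of_int j :: 4)" using Cons.prems(3) by (simp add: rot_letter_inject)
  then have "i = j" using small_int_4_inject[of i j] Cons.prems by auto
  then show ?case using Cons by auto
qed

text \<open>Adjacent letters cancel only if their indices differ by 2, which exponents in {-1, 0, 1}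
  cannot produce. The extra letter in front carries the induction.\<close>

lemma reduced_rot_path: "set is \<subseteq> {-1, 0, 1} \<Longrightarrow> reduced (rot_letter s # rot_path s is)"
proof (induction "is" arbitrary: s)
  case (Cons i "is")
  then have "of_int i \<noteq> (2 :: 4)" by auto
  then show ?case using Cons by (simp add: letter_inv_rot_letter rot_letter_inject)
qed simp

lemma rot_path_surj:
  "reduced (rot_letter s # ys) \<Longrightarrow> \<exists>is. set is \<subseteq> {-1, 0, 1} \<and> ys = rot_path s is"
proof (induction ys arbitrary: s)
  case Nil
  then show ?case by (intro exI[of _ "[]"]) simp
next
  case (Cons y ys)
  obtain t where t: "y = rot_letter (s + (t - s))" using rot_letter_surj[of y] by auto
  have "t - s \<noteq> 2" using Cons.prems by (auto simp: t letter_inv_rot_letter diff_eq_eq add.commute)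
  then obtain i where i: "i \<in> {-1, 0, 1}" "t - s = of_int i" by (rule small_int_4_cases)
  then have y: "y = rot_letter (s + of_int i)" by (simp add: t)
  then obtain "is" where "set is \<subseteq> {-1, 0, 1}" "ys = rot_path (s + of_int i) is"
    using Cons.IH[of "s + of_int i"] Cons.prems by auto
  then show ?case using i(1) y by (intro exI[of _ "i # is"]) auto
qed

text \<open>A path starting at 0 has a virtual \<open>a\<close> in front, which its first letter may
  not cancel. So a preceding power of \<open>La_inv\<close> stays recognizable as the maximal
  leading block.\<close>

lemma hd_rot_path: "set is \<subseteq> {-1, 0, 1} \<Longrightarrow> rot_path 0 is \<noteq> La_inv # ys"
  using reduced_rot_path[of "is" 0] by (cases "rot_path 0 is") (auto simp: rot_letter_def)

lemma replicate_append_inject: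
  assumes "replicate n x @ p = replicate m x @ q" "\<And>ys. p \<noteq> x # ys" "\<And>ys. q \<noteq> x # ys"
  shows "n = m \<and> p = q"
  using assms(1)
proof (induction n arbitrary: m)
  case 0
  then show ?case using assms by (cases m) auto
next
  case (Suc n)
  then show ?case using assms by (cases m) auto
qed

text \<open>Here the condition on the first exponent enters: a nonzero one makes the path start with
  a letter other than \<open>a\<close>, so nothing cancels against the leading
  \<open>La_inv\<close>.\<close>

lemma reduced_nf_word:
  assumes "nf_admissible (n, is, k)"
  shows "reduced (replicate n La_inv @ rot_path 0 is)"
proof (cases "n = 0 \<or> is = []")
  case True
  then show ?thesis
    using assms reduced_negative[of n] reduced_rot_path[of "is" 0]
    by (auto simp: nf_admissible_def dest: reduced_ConsD)
next
  case False
  then obtain i js where [simp]: "is = i # js" by (cases "is") auto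
  have "i \<in> {-1, 1}" using assms False by (auto simp: nf_admissible_def)
  then have "rot_letter (of_int i) \<noteq> La" by (auto simp: rot_letter_def)
  then show ?thesis
    using assms False reduced_negative[of n] reduced_rot_path[of "is" 0]
    by (auto simp: nf_admissible_def reduced_def successively_append_iff)
qed

text \<open>The leading \<open>La_inv\<close> block of the reduced word gives \<open>n\<close>, the
  rest gives the exponents, and the \<alpha>-component then gives the last exponent.\<close>

lemma nf_value_inject:
  assumes t: "nf_admissible t" "nf_admissible t'" and eq: "nf_value t = nf_value t'"
  shows "t = t'"
proof -
  obtain n "is" k m js l where [simp]: "t = (n, is, k)" "t' = (m, js, l)"
    by (cases t, cases t') auto
  have inj: "v = w" if "alpha_act s v = alpha_act s w" for s v w
    using arg_cong[OF that, of "alpha_act (- s)"] by (simp flip: alpha_act_add)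
  have s: "of_int (sum_list is) + k = of_int (sum_list js) + l"
    using eq by (simp add: nf_value_eq)
  then have "of_letters (replicate n La_inv @ rot_path 0 is) = of_letters (replicate m La_inv @ rot_path 0 js)"
    using eq by (auto simp: nf_value_eq dest: inj)
  then have "replicate n La_inv @ rot_path 0 is = replicate m La_inv @ rot_path 0 js"
    using t by (metis \<open>t = _\<close> \<open>t' = _\<close> reduced_nf_word word_of_letters)
  moreover have sets: "set is \<subseteq> {-1, 0, 1}" "set js \<subseteq> {-1, 0, 1}"
    using t by (auto simp: nf_admissible_def)
  ultimately have "n = m" "rot_path 0 is = rot_path 0 js"
    using replicate_append_inject hd_rot_path by metis+
  moreover from this have "is = js" using rot_path_inject[OF sets] by simp
  ultimately show ?thesis using s by simp
qed

lemma nf_value_surj: "\<exists>t. nf_admissible t \<and> nf_value t = x"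
proof (cases x)
  case (Grp j w)
  \<comment> \<open>Moving the power of \<alpha> in \<open>Grp j w\<close> to the right replaces
    \<open>w\<close> by \<open>alpha_act j w\<close>.\<close>
  define xs where "xs = word (alpha_act j w)"
  define n where "n = length (takeWhile (\<lambda>l. l = La_inv) xs)"
  define ys where "ys = dropWhile (\<lambda>l. l = La_inv) xs"
  have "takeWhile (\<lambda>l. l = La_inv) xs = replicate n La_inv"
    unfolding n_def by (metis (full_types) replicate_length_same set_takeWhileD)
  then have xs: "xs = replicate n La_inv @ ys"
    unfolding ys_def by (metis takeWhile_dropWhile_id)
  have red: "reduced (replicate n La_inv @ ys)" unfolding xs[symmetric] xs_def by (rule reduced_word)
  have "ys = [] \<or> hd ys \<noteq> La_inv" unfolding ys_def by (metis (full_types) hd_dropWhile)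
  then have "reduced (rot_letter 0 # ys)"
    using red by (cases ys) (auto simp: rot_letter_def reduced_def successively_append_iff)
  then obtain "is" where "is": "set is \<subseteq> {-1, 0, 1}" "ys = rot_path 0 is" using rot_path_surj by blast
  let ?t = "(n, is, j - of_int (sum_list is))"
  have "hd is \<noteq> 0" if n: "n > 0" and ne: "is \<noteq> []"
  proof
    assume "hd is = 0"
    then obtain js where "is = 0 # js" using ne by (cases "is") auto
    then show False using red n "is"(2)
      by (auto simp: rot_letter_def reduced_def successively_append_iff)
  qed
  then have "nf_admissible ?t" using "is"(1) by (auto simp: nf_admissible_def)
  moreover have "nf_value ?t = x"
  proof -
    have "of_letters (replicate n La_inv @ rot_path 0 is) = alpha_act j w"
      unfolding "is"(2)[symmetric] xs[symmetric] xs_def by (rule of_letters_word)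
    then show ?thesis by (simp add: nf_value_eq Grp flip: alpha_act_add)
  qed
  ultimately show ?thesis by blast
qed

lemma normal_form_value:
  assumes "nf_admissible t"
  shows "normal_form (nf_value t) = t"
  unfolding normal_form_def using assms nf_value_inject by (intro the_equality) auto

section \<open>Right multiplication in normal form\<close>

lemma nf_value_append:
  "nf_value (n, is @ [i], k) = nf_value (n, is, of_int i) * (of_free2 gen_a * alpha_pow k)"
  by (simp add: nf_value_def alpha_pow_of_int mult.assoc)

lemma nf_value_alpha_pow: "nf_value (n, is, k) * alpha_pow j = nf_value (n, is, k + j)"
  by (simp add: nf_value_def mult.assoc alpha_pow_add)

lemma nf_value_gen_a: "nf_value (n, is, of_int i) * of_free2 gen_a = nf_value (n, is @ [i], 0)"
  by (simp add: nf_value_append alpha_pow_def flip: one_grp_def)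

lemma nf_value_gen_a_2: "nf_value (n, is @ [i], 2) * of_free2 gen_a = nf_value (n, is, of_int i + 2)"
proof -
  have "alpha_act 2 gen_a = inverse gen_a"
    unfolding alpha_act_gen_a by (simp add: gen_a_eq inverse_letter rot_letter_def)
  then have "of_free2 gen_a * (alpha_pow 2 * of_free2 gen_a) = alpha_pow 2"
    by (metis alpha_pow_of_free2 free2_right_inverse mult.assoc mult_1_left of_free2_mult of_free2_one)
  then show ?thesis by (simp add: nf_value_append mult.assoc flip: nf_value_alpha_pow)
qed

lemma nf_value_reduce: "nf_value (Suc n, 0 # is, k) = nf_value (n, is, k)"
proof -
  have "inverse g * (g * x) = x" for g x :: grp
    by (metis grp_left_inverse mult.assoc mult_1_left)
  then show ?thesis
    by (simp only: nf_value_def power_Suc2 prod.case list.map prod_list.Cons power_int_0_right mult.assoc mult_1_left)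
qed
subsection \<open>Suffix codes in \<open>Y\<close>\<close>

lemma Y_set_inverse_gen_a_power: "inverse gen_a ^ n \<in> Y_set"
proof -
  have "word (inverse gen_a ^ n) = replicate n La_inv"
    by (metis gen_a_eq inverse_letter letter_inv.simps(1) of_letters_replicate reduced_negative word_of_letters)
  then show ?thesis by (auto simp: Y_set_iff Y_word_def intro: exI[of _ n] exI[of _ "[]"])
qed

text \<open>By \<open>Y_set_last\<close>, exactly one of \<open>a\<close> and \<open>b\<close> can
  be split off on the right within \<open>Y\<close>, even for a negative power of \<open>a\<close>,
  which splits off \<open>a\<close>. This plays the part of a last letter in all suffix
  arguments.\<close>

lemma Y_set_a_neq_b: "y \<in> Y_set \<Longrightarrow> y' \<in> Y_set \<Longrightarrow> y * gen_a \<noteq> y' * gen_b"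
  using Y_set_last[OF Y_set_right_a[of y]]
  by (metis free2_right_inverse mult.assoc mult_1_right)

lemma Y_set_cases:
  assumes "y \<in> Y_set"
  obtains z where "z \<in> Y_set" "y = z * gen_a" | z where "z \<in> Y_set" "y = z * gen_b"
proof -
  have "y = y * inverse g * g" for g by (simp add: mult.assoc)
  then show ?thesis using Y_set_last[OF assms] that by metis
qed

lemma Y_set_v:
  assumes "y \<in> Y_set"
  shows "y * v_elt k \<in> Y_set"
  using assms by (auto simp: v_elt_def power2_eq_square Y_set_right_a Y_set_right_b simp flip: mult.assoc)

lemma Y_set_u:
  assumes "y \<in> Y_set"
  shows "y * u_elt i \<in> Y_set"
  using assms by (auto simp: u_elt_def power2_eq_square Y_set_right_a Y_set_right_b simp flip: mult.assoc)

lemma v_elt_suffix: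
  assumes "y \<in> Y_set" "y' \<in> Y_set"
  shows "y * v_elt k = y' * v_elt l \<longleftrightarrow> y = y' \<and> k = l"
  using assms four_cases[of k] four_cases[of l]
  by (auto simp: v_elt_def power2_eq_square Y_set_right_a Y_set_right_b Y_set_a_neq_b
       Y_set_a_neq_b[symmetric] free2_right_cancel simp flip: mult.assoc)

text \<open>The code words are \<open>a\<close>, \<open>ab\<close> and \<open>bb\<close>, none a
  suffix of another; comparing last letters separates them.\<close>

lemma u_elt_suffix:
  assumes "y \<in> Y_set" "y' \<in> Y_set" "i \<in> {-1, 0, 1}" "j \<in> {-1, 0, 1}"
  shows "y * u_elt i = y' * u_elt j \<longleftrightarrow> y = y' \<and> i = j"
  using assms
  by (auto simp: u_elt_def power2_eq_square Y_set_right_a Y_set_right_b Y_set_a_neq_b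
       Y_set_a_neq_b[symmetric] free2_right_cancel simp flip: mult.assoc)

lemma v_elt_suffix_exists:
  assumes "y \<in> Y_set"
  obtains z k where "z \<in> Y_set" "y = z * v_elt k"
proof -
  obtain z l where z: "z \<in> Y_set" "y = z * l" "l \<in> {gen_a, gen_b}"
    using assms by (rule Y_set_cases) auto
  obtain z' l' where z': "z' \<in> Y_set" "z = z' * l'" "l' \<in> {gen_a, gen_b}"
    using z(1) by (rule Y_set_cases) auto
  obtain k where "l' * l = v_elt k"
  proof -
    have "v_elt 0 = gen_a * gen_a" "v_elt 1 = gen_b * gen_b"
      "v_elt 2 = gen_a * gen_b" "v_elt 3 = gen_b * gen_a"
      by (simp_all add: v_elt_def power2_eq_square)
    then show ?thesis using that z(3) z'(3) by (metis insertE empty_iff)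
  qed
  then show ?thesis using that z z' by (metis mult.assoc)
qed

section \<open>Elements of \<open>Y\<close> as products of the \<open>u_elt i\<close>\<close>

definition tail_value :: "nat \<Rightarrow> int list \<Rightarrow> free2" where
  "tail_value n is = inverse gen_a ^ n * prod_list (map u_elt is)"

lemma tail_value_Nil: "tail_value n [] = inverse gen_a ^ n"
  by (simp add: tail_value_def)

lemma tail_value_append: "tail_value n (is @ [i]) = tail_value n is * u_elt i"
  by (simp add: tail_value_def mult.assoc)

lemma tail_value_reduce: "tail_value (Suc n) (0 # is) = tail_value n is"
proof -
  have "inverse g * (g * x) = x" for g x :: free2
    by (metis free2_left_inverse mult.assoc mult_1_left)
  moreover have "u_elt 0 = gen_a" by (simp add: u_elt_def)
  ultimately show ?thesis
    by (simp only: tail_value_def power_Suc2 list.map prod_list.Cons mult.assoc)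
qed

lemma tail_value_in_Y: "tail_value n is \<in> Y_set"
  by (induction "is" rule: rev_induct)
     (simp_all add: tail_value_append Y_set_u tail_value_Nil Y_set_inverse_gen_a_power)

lemma inverse_gen_a_power_inject: "inverse gen_a ^ n = inverse gen_a ^ m \<Longrightarrow> n = m"
  by (metis gen_a_eq inverse_letter length_replicate letter_inv.simps(1) of_letters_replicate
      reduced_negative word_of_letters)

lemma inverse_gen_a_power_eq_u:
  assumes "inverse gen_a ^ n = y * u_elt i" "y \<in> Y_set" "i \<in> {-1, 0, 1}"
  shows "i = 0 \<and> y = inverse gen_a ^ Suc n"
proof -
  have "y * u_elt i = inverse gen_a ^ Suc n * u_elt 0"
    by (simp only: assms(1)[symmetric]) (simp add: u_elt_def power_Suc2 mult.assoc del: power_Suc)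
  then show ?thesis
    using u_elt_suffix[OF assms(2) Y_set_inverse_gen_a_power[of "Suc n"] assms(3), of 0] by blast
qed

text \<open>Only \<open>u_elt 0\<close> can be split off a negative power of \<open>a\<close>.
  Peeling thus forces all exponents to be 0 and \<open>m\<close> to be positive, and then a first
  exponent 0 is not admissible.\<close>

lemma tail_value_eq_power:
  "nf_admissible (m, js, k) \<Longrightarrow> tail_value m js = inverse gen_a ^ n \<Longrightarrow> js = []"
proof (induction js arbitrary: n rule: rev_induct)
  case (snoc j js)
  then have adm: "nf_admissible (m, js, k)"
    by (cases js) (auto simp: nf_admissible_def)
  from snoc.prems have "j = 0 \<and> tail_value m js = inverse gen_a ^ Suc n"
    by (intro inverse_gen_a_power_eq_u)
       (auto simp: nf_admissible_def tail_value_append tail_value_in_Y)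
  moreover from this have "js = []"
    using snoc.IH[of "Suc n"] adm by blast
  ultimately show ?case
    using snoc.prems inverse_gen_a_power_inject[of m "Suc n"] by (auto simp: nf_admissible_def tail_value_Nil)
qed simp

lemma tail_value_inject:
  "nf_admissible (n, is, k) \<Longrightarrow> nf_admissible (m, js, l) \<Longrightarrow> tail_value n is = tail_value m js \<Longrightarrow>
   n = m \<and> is = js"
proof (induction "is" arbitrary: js rule: rev_induct)
  case Nil
  then have "js = []" using tail_value_eq_power[of m js l n] by (simp add: tail_value_Nil)
  with Nil show ?case by (simp add: tail_value_Nil inverse_gen_a_power_inject)
next
  case (snoc i "is")
  show ?case
  proof (cases js rule: rev_cases)
    case Nil
    then show ?thesis
      using snoc.prems tail_value_eq_power[OF snoc.prems(1), of m] by (simp add: tail_value_Nil)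
  next
    case (snoc js' j)
    have adm: "nf_admissible (n, is, k)" "nf_admissible (m, js', l)" "i \<in> {-1, 0, 1}" "j \<in> {-1, 0, 1}"
      using snoc.prems snoc by (auto simp: nf_admissible_def hd_append split: if_splits)
    with snoc.prems snoc have "tail_value n is = tail_value m js' \<and> i = j"
      by (simp add: tail_value_append u_elt_suffix tail_value_in_Y)
    with snoc.IH[OF adm(1,2)] snoc show ?thesis by simp
  qed
qed

text \<open>The positive part is parsed from the right into \<open>a\<close>, \<open>ab\<close> and
  \<open>bb\<close>.\<close>

lemma tail_value_surj:
  assumes "y \<in> Y_set"
  shows "\<exists>n is. set is \<subseteq> {-1, 0, 1} \<and> y = tail_value n is"
proof -
  obtain n ps where ps: "set ps \<subseteq> {La, Lb}" "word y = replicate n La_inv @ ps"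
    using assms by (auto simp: Y_set_iff Y_word_def)
  have y: "y = inverse gen_a ^ n * of_letters ps"
    by (metis ps(2) gen_a_eq inverse_letter letter_inv.simps(1) of_letters_append of_letters_replicate of_letters_word)
  have "\<exists>n is. set is \<subseteq> {-1, 0, 1} \<and> inverse gen_a ^ m * of_letters ps = tail_value n is" for m
    using ps(1)
  proof (induction "length ps" arbitrary: ps rule: less_induct)
    case less
    have step: ?case if split: "ps = qs @ rs" "rs \<noteq> []" "of_letters rs = u_elt i" "i \<in> {-1, 0, 1}" for qs rs i
    proof -
      obtain n "is" where "set is \<subseteq> {-1, 0, 1}" "inverse gen_a ^ m * of_letters qs = tail_value n is"
        using less(1)[of qs] less(2) split by auto
      then show ?thesis using split
        by (intro exI[of _ n] exI[of _ "is @ [i]"])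
           (simp add: of_letters_append tail_value_append flip: mult.assoc)
    qed
    show ?case
    proof (cases ps rule: rev_cases)
      case Nil
      then show ?thesis by (intro exI[of _ m] exI[of _ "[]"]) (simp add: tail_value_Nil)
    next
      case (snoc qs l)
      consider "l = La" | "l = Lb" "qs = []" | rs where "l = Lb" "qs = rs @ [La]"
        | rs where "l = Lb" "qs = rs @ [Lb]"
        using less(2) snoc by (cases qs rule: rev_cases) auto
      then show ?thesis
      proof cases
        case 1
        then show ?thesis
          using snoc by (intro step[of qs "[La]" 0]) (simp_all add: u_elt_def of_letters_Cons gen_a_eq)
      next
        case 2
        \<comment> \<open>A single remaining \<open>b\<close> borrows an \<open>a\<close> from the
          power in front: \<open>b\<close> is \<open>a^-1\<close> times \<open>ab\<close>.\<close>
        have "inverse gen_a ^ m * gen_b = inverse gen_a ^ Suc m * (gen_a * gen_b)"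
          by (simp only: power_Suc2 mult.assoc) (metis free2_left_inverse mult.assoc mult_1_left)
        then show ?thesis
          using snoc 2 by (intro exI[of _ "Suc m"] exI[of _ "[-1]"])
            (simp add: tail_value_def u_elt_def of_letters_Cons gen_b_eq)
      next
        case 3
        then show ?thesis
          using snoc by (intro step[of rs "[La, Lb]" "-1"]) (simp_all add: u_elt_def of_letters_Cons gen_a_eq gen_b_eq)
      next
        case 4
        then show ?thesis
          using snoc by (intro step[of rs "[Lb, Lb]" 1])
            (simp_all add: u_elt_def of_letters_Cons gen_b_eq power2_eq_square)
      qed
    qed
  qed
  then show ?thesis using y by blast
qed

section \<open>Values and bijectivity of \<open>Phi\<close>\<close>

lemma nf_value_admissible_Phi:
  assumes "nf_admissible (n, is, k)"
  shows "Y_elt (Phi (nf_value (n, is, k))) = tail_value n is * v_elt (- k)"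
  using Y_set_v[OF tail_value_in_Y]
  by (simp add: Phi_def nf_h_def normal_form_value[OF assms] tail_value_def Abs_Y_inverse)

text \<open>The condition on \<open>i\<^sub>0\<close> is dropped here: both sides are invariant under the reduction
  \<open>a\<^sup>-\<^sup>1 \<alpha>\<^sup>0 a = 1\<close>, because \<open>u\<^sub>0 = a\<close>. This avoids special cases in the multiplication rules.\<close>

lemma Phi_nf_value:
  "set is \<subseteq> {-1, 0, 1} \<Longrightarrow> Y_elt (Phi (nf_value (n, is, k))) = tail_value n is * v_elt (- k)"
proof (induction "is" arbitrary: n)
  case Nil
  show ?case by (rule nf_value_admissible_Phi) (simp add: nf_admissible_def)
next
  case (Cons i "is")
  show ?case
  proof (cases "n > 0 \<and> i = 0")
    case True
    then obtain m where "n = Suc m" by (cases n) auto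
    then show ?thesis using True Cons by (simp add: nf_value_reduce tail_value_reduce)
  next
    case False
    then show ?thesis using Cons by (intro nf_value_admissible_Phi) (auto simp: nf_admissible_def)
  qed
qed

lemma inj_Phi: "inj Phi"
proof (rule injI)
  fix x x' assume eq: "Phi x = Phi x'"
  obtain n "is" k m js l where t: "nf_admissible (n, is, k)" "nf_value (n, is, k) = x"
      "nf_admissible (m, js, l)" "nf_value (m, js, l) = x'"
    by (metis nf_value_surj prod_cases3)
  then have "tail_value n is * v_elt (- k) = tail_value m js * v_elt (- l)"
    using eq nf_value_admissible_Phi[OF t(1)] nf_value_admissible_Phi[OF t(3)] by simp
  then show "x = x'"
    using tail_value_inject[OF t(1,3)] t by (simp add: v_elt_suffix tail_value_in_Y)
qed

lemma Phi_nf_value_cases: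
  obtains n "is" k where "set is \<subseteq> {-1, 0, 1}" "y = Phi (nf_value (n, is, k))"
proof -
  obtain z k where z: "z \<in> Y_set" "Y_elt y = z * v_elt k"
    using Y_elt[of y] by (rule v_elt_suffix_exists)
  obtain n "is" where "is": "set is \<subseteq> {-1, 0, 1}" "z = tail_value n is"
    using tail_value_surj[OF z(1)] by auto
  have "Y_elt (Phi (nf_value (n, is, - k))) = Y_elt y"
    by (simp add: Phi_nf_value "is" z(2))
  then have "y = Phi (nf_value (n, is, - k))" by (simp add: Y_elt_inject)
  then show ?thesis by (rule that[OF "is"(1)])
qed
subsection \<open>Conjugation by \<open>U\<close>\<close>

lemma adj_eqI:
  fixes T :: "'a ell2 \<Rightarrow>\<^sub>L 'b ell2"
  assumes "clinear_op T"
    and "\<And>f g. cinner (blinfun_apply T f) g = cinner f (blinfun_apply S g)"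
  shows "adj T = S"
  using ex1_adj[OF assms(1)] cinner_adj[OF assms(1)] assms(2) by blast

lemma cinner_commute: "cinner f g = cnj (cinner g f)"
  unfolding cinner_def infsum_cnj[symmetric] by (simp add: mult.commute)

lemma adj_adj:
  assumes "clinear_op T"
  shows "adj (adj T) = T"
proof (rule adj_eqI[OF clinear_adj[OF assms]])
  fix f g
  show "cinner (blinfun_apply (adj T) f) g = cinner f (blinfun_apply T g)"
    using cinner_adj[OF assms, of g f] cinner_commute[of "blinfun_apply (adj T) f" g]
      cinner_commute[of f "blinfun_apply T g"] by simp
qed

lemma adj_compose:
  assumes "clinear_op S" "clinear_op T"
  shows "adj (S o\<^sub>L T) = adj T o\<^sub>L adj S"
  using assms by (intro adj_eqI clinear_compose) (simp_all add: cinner_adj)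

lemma clinear_scale_op: "clinear_op T \<Longrightarrow> clinear_op (scale_op c T)"
  unfolding clinear_op_def scale_op_apply
  by (auto intro!: ell2_eqI simp: cinner_scaleC_right)

text \<open>The ambient operators are only real-linear, so the preimage below must carry complex
  linearity as a closed condition.\<close>

lemma closed_clinear_op: "closed {T :: 'a ell2 \<Rightarrow>\<^sub>L 'b ell2. clinear_op T}"
proof -
  have "{T :: 'a ell2 \<Rightarrow>\<^sub>L 'b ell2. clinear_op T} = (\<Inter>c. \<Inter>f. {T. blinfun_apply T (c *\<^sub>C f) = c *\<^sub>C blinfun_apply T f})"
    by (auto simp: clinear_op_def)
  moreover have "closed {T :: 'a ell2 \<Rightarrow>\<^sub>L 'b ell2. blinfun_apply T (c *\<^sub>C f) = c *\<^sub>C blinfun_apply T f}" for c f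
    by (intro closed_Collect_eq linear_continuous_on bounded_linear_compose[OF bounded_linear_scaleC]
        blinfun.bounded_linear_left)
  ultimately show ?thesis by (auto intro!: closed_INT)
qed

lemma U_op_ket: "blinfun_apply U_op (ket x) = ket (Phi x)"
  unfolding U_op_def using inj_Phi by (subst basis_op_ket) (auto dest: injD)

lemma clinear_U_op: "clinear_op U_op"
  unfolding U_op_def by (rule clinear_basis_op)

lemma adj_U_op_ket: "blinfun_apply (adj U_op) (ket (Phi x)) = ket x"
proof (rule ell2_eqI)
  fix z
  show "cinner (ket z) (blinfun_apply (adj U_op) (ket (Phi x))) = cinner (ket z) (ket x)"
    using inj_Phi
    by (auto simp: cinner_adj[OF clinear_U_op, symmetric] U_op_ket cinner_ket_left ket.rep_eq dest: injD)
qed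

lemma U_op_isometry: "adj U_op o\<^sub>L U_op = id_blinfun"
  by (rule op_eqI)
     (auto intro: clinear_compose clinear_adj clinear_U_op clinear_id simp: U_op_ket adj_U_op_ket)

lemma Phi_star_compose: "Phi_star (S o\<^sub>L T) = Phi_star S o\<^sub>L Phi_star T"
proof -
  have "blinfun_apply (adj U_op) (blinfun_apply U_op f) = f" for f
    using arg_cong[OF U_op_isometry, of "\<lambda>T. blinfun_apply T f"] by simp
  then show ?thesis by (intro blinfun_eqI) (simp add: Phi_star_def)
qed

lemma clinear_Phi_star: "clinear_op T \<Longrightarrow> clinear_op (Phi_star T)"
  unfolding Phi_star_def by (intro clinear_compose clinear_adj clinear_U_op)

lemma Phi_star_adj: "clinear_op T \<Longrightarrow> Phi_star (adj T) = adj (Phi_star T)"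
  unfolding Phi_star_def
  by (simp add: adj_compose adj_adj clinear_compose clinear_adj clinear_U_op)
     (rule blinfun_eqI, simp)

lemma bounded_linear_Phi_star: "bounded_linear Phi_star"
  unfolding Phi_star_def
  by (intro bounded_linear_compose[OF bounded_bilinear.bounded_linear_left[OF bounded_bilinear_blinfun_compose]]
      bounded_bilinear.bounded_linear_right[OF bounded_bilinear_blinfun_compose])

lemma Phi_star_scale_op: "Phi_star (scale_op c T) = scale_op c (Phi_star T)"
  using clinear_U_op by (intro blinfun_eqI) (simp add: Phi_star_def scale_op_apply clinear_op_def)

text \<open>Reduces the inclusion of the generated algebra to a check on its generators.\<close>

lemma cstar_subalgebra_vimage_Phi_star:
  assumes A: "cstar_subalgebra A"
  shows "cstar_subalgebra {T. clinear_op T \<and> Phi_star T \<in> A}"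
proof -
  note Phi_star_linear = bounded_linear.linear[OF bounded_linear_Phi_star]
  have "closed ({T. clinear_op T} \<inter> Phi_star -` A)"
  proof (intro closed_Int closed_clinear_op closed_vimage)
    show "closed A" using A by (simp add: cstar_subalgebra_def)
    show "continuous_on UNIV Phi_star" by (rule linear_continuous_on[OF bounded_linear_Phi_star])
  qed
  moreover have "{T. clinear_op T \<and> Phi_star T \<in> A} = {T. clinear_op T} \<inter> Phi_star -` A" by auto
  moreover have "clinear_op (0 :: grp ell2 \<Rightarrow>\<^sub>L grp ell2)"
    unfolding clinear_op_def blinfun.zero_left
    by (metis ell2_eqI cinner_ket_left mult_zero_right scaleC.rep_eq zero_ell2.rep_eq)
  moreover have "Phi_star (S + T) = Phi_star S + Phi_star T" for S T
    by (rule linear_add[OF Phi_star_linear])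
  moreover have "Phi_star 0 = 0" by (rule linear_0[OF Phi_star_linear])
  ultimately show ?thesis
    using A unfolding cstar_subalgebra_def
    by (simp add: clinear_plus clinear_compose clinear_scale_op clinear_adj
          Phi_star_compose Phi_star_scale_op Phi_star_adj)
qed

subsection \<open>Right multiplications as suffix replacements\<close>

lemma grp_right_cancel: "x * z = y * z \<longleftrightarrow> x = y" for x y z :: grp
proof
  assume eq: "x * z = y * z"
  have "inverse (inverse z) = z"
    by (metis grp_left_inverse mult.assoc mult_1_left mult_1_right)
  then have "z * inverse z = 1" by (metis grp_left_inverse)
  then show "x = y" by (metis eq mult.assoc mult_1_right)
qed simp

text \<open>Defined for all of \<open>G\<close>, since the generator \<alpha> lies outside the free
  group.\<close>

definition grp_mult_op :: "grp \<Rightarrow> (grp ell2 \<Rightarrow>\<^sub>L grp ell2)" where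
  "grp_mult_op z = basis_op (\<lambda>x. Some (x * z))"

lemma grp_mult_op_ket: "blinfun_apply (grp_mult_op z) (ket x) = ket (x * z)"
  unfolding grp_mult_op_def by (subst basis_op_ket) (auto simp: grp_right_cancel)

lemma clinear_grp_mult_op: "clinear_op (grp_mult_op z)"
  unfolding grp_mult_op_def by (rule clinear_basis_op)

lemma grp_mult_op_mult: "grp_mult_op (y * z) = grp_mult_op z o\<^sub>L grp_mult_op y"
  by (rule op_eqI)
     (auto intro: clinear_compose clinear_grp_mult_op simp: grp_mult_op_ket mult.assoc)

lemma Phi_star_grp_mult_op:
  "blinfun_apply (Phi_star (grp_mult_op z)) (ket (Phi x)) = ket (Phi (x * z))"
  by (simp add: Phi_star_def adj_U_op_ket grp_mult_op_ket U_op_ket)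

text \<open>A single translation by \<open>inverse w * w'\<close> could have a larger domain;
  passing through \<open>y * inverse w\<close> in \<open>Y\<close> confines it to the elements with
  suffix \<open>w\<close>.\<close>

definition suffix_op :: "free2 \<Rightarrow> free2 \<Rightarrow> (Y ell2 \<Rightarrow>\<^sub>L Y ell2)" where
  "suffix_op w' w = partial_translation_op w' o\<^sub>L partial_translation_op (inverse w)"

lemma clinear_suffix_op: "clinear_op (suffix_op w' w)"
  unfolding suffix_op_def by (intro clinear_compose clinear_partial_translation_op)

lemma suffix_op_ket:
  assumes "Y_elt y = p * w" "Y_elt y' = p * w'" "p \<in> Y_set"
  shows "blinfun_apply (suffix_op w' w) (ket y) = ket y'"
proof -
  have "Abs_Y (p * w') = y'" by (metis Y_elt_inverse assms(2))
  then show ?thesis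
    using assms Y_elt[of y']
    by (simp add: suffix_op_def partial_translation_op_ket mult.assoc Abs_Y_inverse)
qed

lemma suffix_op_ket_eq_0:
  assumes "\<And>q. q \<in> Y_set \<Longrightarrow> Y_elt y \<noteq> q * w"
  shows "blinfun_apply (suffix_op w' w) (ket y) = 0"
proof -
  have "Y_elt y * inverse w \<notin> Y_set"
    using assms[of "Y_elt y * inverse w"] by (auto simp: mult.assoc)
  then show ?thesis
    by (simp add: suffix_op_def partial_translation_op_ket blinfun.zero_right)
qed

lemma suffix_op_v_elt:
  assumes "Y_elt y = p * v_elt k" "p \<in> Y_set" "j = k \<Longrightarrow> Y_elt y' = p * w'"
  shows "blinfun_apply (suffix_op w' (v_elt j)) (ket y) = (if j = k then ket y' else 0)"
  using assms by (auto simp: suffix_op_ket suffix_op_ket_eq_0 v_elt_suffix)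

lemma suffix_op_u_elt_v_elt:
  assumes "Y_elt y = p * u_elt i * v_elt k" "p \<in> Y_set" "i \<in> {-1, 0, 1}" "j \<in> {-1, 0, 1}"
    "j = i \<Longrightarrow> k = l \<Longrightarrow> Y_elt y' = p * w'"
  shows "blinfun_apply (suffix_op w' (u_elt j * v_elt l)) (ket y) = (if j = i \<and> k = l then ket y' else 0)"
proof (cases "j = i \<and> k = l")
  case True
  then show ?thesis using assms by (simp add: suffix_op_ket mult.assoc)
next
  case False
  have "q * u_elt j \<in> Y_set" if "q \<in> Y_set" for q using that by (rule Y_set_u)
  then have "Y_elt y \<noteq> q * (u_elt j * v_elt l)" if "q \<in> Y_set" for q
    using that False assms(1-4)
    by (simp add: v_elt_suffix u_elt_suffix Y_set_u flip: mult.assoc)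
  then show ?thesis unfolding if_not_P[OF False] by (rule suffix_op_ket_eq_0)
qed

text \<open>Multiplying by \<alpha> raises the last exponent by 1 and so lowers \<open>nf_h\<close>
  by 1: \<open>v_elt j\<close> becomes \<open>v_elt (j - 1)\<close>, indices modulo 4.\<close>

lemma Phi_star_grp_mult_op_alpha:
  "Phi_star (grp_mult_op alpha) =
     suffix_op (v_elt 3) (v_elt 0) + suffix_op (v_elt 0) (v_elt 1) +
     suffix_op (v_elt 1) (v_elt 2) + suffix_op (v_elt 2) (v_elt 3)" (is "_ = ?R")
proof (rule op_eqI)
  show "clinear_op (Phi_star (grp_mult_op alpha))"
    by (intro clinear_Phi_star clinear_grp_mult_op)
  show "clinear_op ?R"
    by (intro clinear_plus clinear_suffix_op)
  fix y
  obtain n "is" k where "is": "set is \<subseteq> {-1, 0, 1}" and y: "y = Phi (nf_value (n, is, k))"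
    by (rule Phi_nf_value_cases)
  define y' where "y' = Phi (nf_value (n, is, k + 1))"
  have "alpha = alpha_pow 1" by (simp add: alpha_def alpha_pow_def)
  then have "nf_value (n, is, k) * alpha = nf_value (n, is, k + 1)"
    by (metis nf_value_alpha_pow)
  then have lhs: "blinfun_apply (Phi_star (grp_mult_op alpha)) (ket y) = ket y'"
    by (simp add: y y'_def Phi_star_grp_mult_op)
  have Y: "Y_elt y = tail_value n is * v_elt (- k)" "Y_elt y' = tail_value n is * v_elt (- k - 1)"
    by (simp_all add: y y'_def Phi_nf_value "is")
  have "blinfun_apply (suffix_op (v_elt i) (v_elt j)) (ket y) = (if j = - k then ket y' else 0)"
    if "i = j - 1" for i j
    using Y that by (intro suffix_op_v_elt[OF _ tail_value_in_Y]) auto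
  from this[of 3 0] this[of 0 1] this[of 1 2] this[of 2 3]
  show "blinfun_apply (Phi_star (grp_mult_op alpha)) (ket y) = blinfun_apply ?R (ket y)"
    unfolding lhs using four_cases[of "- k"] by (auto simp: blinfun.add_left)
qed

text \<open>Right multiplication by \<open>a\<close> appends \<open>i\<^sub>d\<close> to the exponents if \<open>i\<^sub>d \<noteq> 2\<close>; for \<open>i\<^sub>d = 2\<close> it
  instead removes \<open>i\<^bsub>d-1\<^esub>\<close> because \<open>a \<alpha>\<^sup>2 a = \<alpha>\<^sup>2\<close>.\<close>

lemma Phi_star_grp_mult_op_gen_a:
  "Phi_star (grp_mult_op (of_free2 gen_a)) =
     suffix_op (u_elt 0 * v_elt 0) (v_elt 0) +
     suffix_op (u_elt 1 * v_elt 0) (v_elt 3) +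
     suffix_op (u_elt (-1) * v_elt 0) (v_elt 1) +
     suffix_op (v_elt 2) (u_elt 0 * v_elt 2) +
     suffix_op (v_elt 1) (u_elt 1 * v_elt 2) +
     suffix_op (v_elt 3) (u_elt (-1) * v_elt 2)" (is "?L = ?R")
proof (rule op_eqI)
  show "clinear_op ?L"
    by (intro clinear_Phi_star clinear_grp_mult_op)
  show "clinear_op ?R"
    by (intro clinear_plus clinear_suffix_op)
  fix y
  obtain n "is" k where nf: "set is \<subseteq> {-1, 0, 1}" "is \<noteq> []" "y = Phi (nf_value (n, is, k))"
  proof -
    obtain n "is" k where t: "set is \<subseteq> {-1, 0, 1}" "y = Phi (nf_value (n, is, k))"
      by (rule Phi_nf_value_cases)
    show ?thesis
    proof (cases "is = []")
      case True
      \<comment> \<open>Inserting \<open>a^-1 \<alpha>^0 a\<close> provides a last exponent that can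
        be removed.\<close>
      then show ?thesis using t by (intro that[of "[0]" "Suc n" k]) (simp_all add: nf_value_reduce)
    next
      case False
      then show ?thesis using t by (intro that)
    qed
  qed
  from nf(2) obtain js i where js: "is = js @ [i]" by (cases "is" rule: rev_cases) simp_all
  let ?p = "tail_value n js" and ?q = "tail_value n is"
  have i: "i \<in> {-1, 0, 1}" "set js \<subseteq> {-1, 0, 1}" using nf(1) js by auto
  have Y: "Y_elt y = ?q * v_elt (- k)" "Y_elt y = ?p * u_elt i * v_elt (- k)"
    using nf by (simp_all add: Phi_nf_value js tail_value_append)
  show "blinfun_apply ?L (ket y) = blinfun_apply ?R (ket y)"
  proof (cases "k = 2")
    case True
    \<comment> \<open>The suffix is \<open>v_elt 2\<close>, so the first three summands vanish. The
      removed exponent \<open>i\<close> makes the last one \<open>i + 2\<close>, so the new index of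
      \<open>v_elt\<close> is \<open>- i - 2\<close>: 2, 1, 3 for \<open>i\<close> = 0, 1,
      -1.\<close>
    define y' where "y' = Phi (nf_value (n, js, of_int i + 2))"
    have lhs: "blinfun_apply ?L (ket y) = ket y'"
      by (simp add: nf True js y'_def Phi_star_grp_mult_op nf_value_gen_a_2)
    have Y': "Y_elt y' = ?p * v_elt (- of_int i - 2)"
      by (simp add: y'_def Phi_nf_value i)
    have u: "blinfun_apply (suffix_op (v_elt l) (u_elt j * v_elt 2)) (ket y) = (if j = i then ket y' else 0)"
      if "j \<in> {-1, 0, 1}" "l = - of_int j - 2" for j l
      using suffix_op_u_elt_v_elt[OF Y(2) tail_value_in_Y i(1) that(1), of 2 y' "v_elt l"] Y' that(2) True
      by simp
    have v: "blinfun_apply (suffix_op w (v_elt j)) (ket y) = 0" if "j \<noteq> 2" for j w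
    proof -
      have "- k = 2" using True by simp
      then show ?thesis
        \<comment> \<open>As \<open>j\<close> differs from \<open>- k\<close>, the premise on the
          target vector is void and any value may stand for it.\<close>
        using suffix_op_v_elt[OF Y(1) tail_value_in_Y, of j undefined w] that by simp
    qed
    show ?thesis
      unfolding lhs using u[of 0 2] u[of 1 1] u[of "-1" 3] i by (auto simp: blinfun.add_left v)
  next
    case False
    then obtain l where l: "l \<in> {-1, 0, 1}" "k = of_int l" by (rule small_int_4_cases)
    \<comment> \<open>Now the last three summands vanish. The suffix \<open>v_elt (- l)\<close>
      turns into \<open>u_elt l * v_elt 0\<close>, with \<open>- l\<close> equal to 0, 3, 1 for
      \<open>l\<close> = 0, 1, -1.\<close>
    define y' where "y' = Phi (nf_value (n, is @ [l], 0))"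
    have lhs: "blinfun_apply ?L (ket y) = ket y'"
      by (simp add: nf l y'_def Phi_star_grp_mult_op nf_value_gen_a)
    have "set (is @ [l]) \<subseteq> {-1, 0, 1}" using nf l by auto
    from Phi_nf_value[OF this, of n 0] have Y': "Y_elt y' = ?q * (u_elt l * v_elt 0)"
      by (simp add: y'_def tail_value_append mult.assoc)
    have v: "blinfun_apply (suffix_op (u_elt j * v_elt 0) (v_elt m)) (ket y) = (if j = l then ket y' else 0)"
      if "j \<in> {-1, 0, 1}" "m = - of_int j" for j m
      using suffix_op_v_elt[OF Y(1) tail_value_in_Y, of m y' "u_elt j * v_elt 0"] Y' that l
        small_int_4_inject[of j l] by simp
    have "- k \<noteq> 2" using False four_cases[of k] by auto
    then have u: "blinfun_apply (suffix_op w (u_elt j * v_elt 2)) (ket y) = 0" if "j \<in> {-1, 0, 1}" for j w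
      using suffix_op_u_elt_v_elt[OF Y(2) tail_value_in_Y i(1) that, of 2] by simp
    show ?thesis
      unfolding lhs using v[of 0 0] v[of 1 3] v[of "-1" 1] u[of 0] u[of 1] u[of "-1"] l
      by (auto simp: blinfun.add_left)
  qed
qed

text \<open>\<open>G\<close> is generated by \<open>\<alpha>\<close> and \<open>a\<close> as a monoid since \<open>\<alpha>\<^sup>4 = 1\<close> and the conjugates of \<open>a\<close> under
  powers of \<open>\<alpha>\<close> are \<open>a, b, a\<^sup>-\<^sup>1, b\<^sup>-\<^sup>1\<close>.\<close>

lemma grp_monoid_induct:
  assumes one: "P 1" and mult: "\<And>x y. P x \<Longrightarrow> P y \<Longrightarrow> P (x * y)"
    and alpha: "P alpha" and gen: "P (of_free2 gen_a)"
  shows "P z"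
proof -
  have "P (alpha ^ n)" for n
    by (induction n) (use one mult alpha in auto)
  then have pow: "P (alpha_pow k)" for k
    using of_nat_cases4[of k] by (auto simp: alpha_pow_of_nat)
  have letter: "P (of_free2 (letter_elt l))" for l
  proof -
    obtain s where s: "l = rot_letter s" using rot_letter_surj by blast
    have "alpha_pow 0 = 1" by (simp add: alpha_pow_def one_grp_def)
    then have "alpha_pow s * of_free2 gen_a * alpha_pow (- s) = of_free2 (letter_elt l)"
      by (simp add: alpha_pow_of_free2 alpha_act_gen_a s mult.assoc alpha_pow_add)
    then show ?thesis by (metis mult pow gen)
  qed
  have word: "P (of_free2 (of_letters xs))" for xs
    by (induction xs) (use one mult letter in \<open>auto simp: of_free2_one of_letters_Cons of_free2_mult\<close>)
  obtain k w where z: "z = Grp k w" by (cases z)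
  have "z = alpha_pow k * of_free2 w" by (simp add: z alpha_pow_def of_free2_def times_grp_def)
  then show ?thesis using mult pow word[of "word w"] by (simp add: of_letters_word)
qed

section \<open>From generators to the C*-algebras\<close>

theorem theorem5:
  shows "Phi_star ` right_regular_algebra \<subseteq> partial_translation_algebra"
proof -
  have "Phi_star T \<in> A"
    if T: "T \<in> right_regular_algebra"
      and A: "cstar_subalgebra A" "range partial_translation_op \<subseteq> A" for T A
  proof -
    have compose: "R o\<^sub>L S \<in> A" and plus: "R + S \<in> A" if "R \<in> A" "S \<in> A" for R S
      using A(1) that by (simp_all add: cstar_subalgebra_def)
    have suffix: "suffix_op w' w \<in> A" for w' w
      unfolding suffix_op_def using A(2) by (intro compose) auto
    have "Phi_star (grp_mult_op z) \<in> A" for z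
    proof (induction z rule: grp_monoid_induct)
      show alpha: "Phi_star (grp_mult_op alpha) \<in> A"
        unfolding Phi_star_grp_mult_op_alpha by (intro plus suffix)
      show "Phi_star (grp_mult_op (of_free2 gen_a)) \<in> A"
        unfolding Phi_star_grp_mult_op_gen_a by (intro plus suffix)
      show "Phi_star (grp_mult_op (x * y)) \<in> A"
        if "Phi_star (grp_mult_op x) \<in> A" "Phi_star (grp_mult_op y) \<in> A" for x y
        unfolding grp_mult_op_mult Phi_star_compose using that by (intro compose)
      \<comment> \<open>\<open>cstar_subalgebra\<close> does not demand a unit, so the identity is
        reached as the product \<open>alpha ^ 4\<close>.\<close>
      then have "Phi_star (grp_mult_op (alpha ^ Suc n)) \<in> A" for n
        by (induction n) (use alpha in auto)
      from this[of 3] show "Phi_star (grp_mult_op 1) \<in> A" by (simp add: alpha_4)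
    qed
    then have "range right_mult_op \<subseteq> {T. clinear_op T \<and> Phi_star T \<in> A}"
      using clinear_grp_mult_op by (auto simp: right_mult_op_def grp_mult_op_def)
    with T cstar_subalgebra_vimage_Phi_star[OF A(1)]
    have "T \<in> {T. clinear_op T \<and> Phi_star T \<in> A}"
      unfolding right_regular_algebra_def hull_def by blast
    then show ?thesis by simp
  qed
  then show ?thesis
    unfolding partial_translation_algebra_def hull_def by blast
qed

end
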